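(* Fix a non-prime integer $K\ge 4$ and suppose $d\ge 1$. Then for every $n\ge1$ and every observable $A\in M_K(\mathbb{C})^{\otimes n}$ of degree at most $d$ (in the Heisenberg--Weyl sense), $$\|\widehat{A}\|_{\frac{2(K-1)d}{(K-1)d+1}}\le C(d,K)\,\|A\|_{\mathrm{op}}$$ with a constant $C(d,K)\le K^{2d}\,\mathrm{BH}_{\Omega_K}^{\le (K-1)d}$. In fact, the factor $K^{2d}$ can be replaced by $|\Sigma_K|^d$, where $|\Sigma_K|$ is the cardinality of $\Sigma_K=\{(\ell,m)\in\mathbb{Z}_K\times\mathbb{Z}_K:\ \ell\text{ and }m\text{ are coprime}\}$.
   Context: An observable is a Hermitian operator; $\|\cdot\|_{\mathrm{op}}$ is the operator norm. $\mathbb{Z}_K=\{0,1,\dots,K-1\}$ is the additive cyclic group of order $K$, $\omega=e^{2\pi i/K}$, and $\Omega_K=\{1,\omega,\dots,\omega^{K-1}\}$. Convention for coprimality: for $(\ell,m)\in\mathbb{Z}_K\times\mathbb{Z}_K$, $\gcd(\ell,m)$ is computed with the representatives of $\ell,m$ in $\{1,2,\dots,K\}$ (so $0$ is replaced by $K$), and coprime means $\gcd(\ell,m)=1$. Heisenberg--Weyl basis: on $\mathbb{C}^K$ with canonical basis $|j\rangle$, $j\in\mathbb{Z}_K$, let $Z|j\rangle=\omega^j|j\rangle$ and $X|j\rangle=|j+1\rangle$ (index mod $K$). The matrices $X^\ell Z^m$, $\ell,m\in\mathbb{Z}_K$, form a basis of $M_K(\mathbb{C})$. Every $A\in M_K(\mathbb{C})^{\otimes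 n}$ has a unique expansion $$A=\sum_{\vec\ell,\vec m\in\mathbb{Z}_K^n}\widehat{A}(\vec\ell,\vec m)\,X^{\ell_1}Z^{m_1}\otimes\cdots\otimes X^{\ell_n}Z^{m_n},$$ and $\|\widehat A\|_p=\big(\sum_{\vec\ell,\vec m}|\widehat A(\vec\ell,\vec m)|^p\big)^{1/p}$. $A$ is of degree at most $d$ if $\widehat{A}(\vec\ell,\vec m)=0$ whenever $\sum_{j=1}^n(\ell_j+m_j)>d$, where $0\le\ell_j,m_j\le K-1$ are taken as integers. Cyclic constant: every $f:\Omega_K^N\to\mathbb{C}$ has a unique expansion $f(z)=\sum_{\alpha}\widehat f(\alpha)z^\alpha$ over $\alpha\in\{0,\dots,K-1\}^N$; $f$ is of degree at most $D$ if $\widehat f(\alpha)=0$ whenever $|\alpha|=\sum_j\alpha_j>D$. $\mathrm{BH}_{\Omega_K}^{\le D}$ denotes the best constant $C$ (known to be finite) such that $\big(\sum_\alpha|\widehat f(\alpha)|^{\frac{2D}{D+1}}\big)^{\frac{D+1}{2D}}\le C\sup_{z\in\Omega_K^N}|f(z)|$ for all $N\ge1$ and all $f:\Omega_K^N\to\mathbb{C}$ of degree at most $D$. *)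

theory Defs
  imports
    "Jordan_Normal_Form.Schur_Decomposition"
    "HOL-Computational_Algebra.Primes"
    "HOL-Library.Extended_Nonnegative_Real"
    "HOL-Library.FuncSet"
begin

section \<open>Index vectors and roots of unity\<close>

definition ZK_vec :: "nat \<Rightarrow> nat \<Rightarrow> (nat \<Rightarrow> nat) set" where
  "ZK_vec K n = {..<n} \<rightarrow>\<^sub>E {..<K}"

definition omega :: "nat \<Rightarrow> complex" where
  "omega K = exp (2 * complex_of_real pi * \<i> / of_nat K)"

definition Omega :: "nat \<Rightarrow> complex set" where
  "Omega K = (\<lambda>j. omega K ^ j) ` {..<K}"

text \<open>Coprimality is tested on the representatives in \<open>{1..K}\<close>, so 0 is read as \<open>K\<close>.\<close>

definition ZK_rep :: "nat \<Rightarrow> nat \<Rightarrow> nat" where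
  "ZK_rep K l = (if l = 0 then K else l)"

definition Sigma_K :: "nat \<Rightarrow> (nat \<times> nat) set" where
  "Sigma_K K = {(l, m). l < K \<and> m < K \<and> coprime (ZK_rep K l) (ZK_rep K m)}"

section \<open>Operators on the tensor power of \<open>\<complex>\<^sup>K\<close>\<close>

text \<open>The \<open>n\<close>-th tensor power of the \<open>K \<times> K\<close> matrices is identified with
  \<open>carrier_mat (K ^ n) (K ^ n)\<close> by means of the Kronecker product.\<close>

definition kronecker :: "complex mat \<Rightarrow> complex mat \<Rightarrow> complex mat" where
  "kronecker A B = mat (dim_row A * dim_row B) (dim_col A * dim_col B)
     (\<lambda>(i, j). A $$ (i div dim_row B, j div dim_col B) * B $$ (i mod dim_row B, j mod dim_col B))"

text \<open>\<open>tensor_mats F n\<close> is \<open>F 0 \<otimes> \<dots> \<otimes> F (n - 1)\<close>.\<close>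

primrec tensor_mats :: "(nat \<Rightarrow> complex mat) \<Rightarrow> nat \<Rightarrow> complex mat" where
  "tensor_mats F 0 = 1\<^sub>m 1"
| "tensor_mats F (Suc n) = kronecker (tensor_mats F n) (F n)"

definition observable :: "complex mat \<Rightarrow> bool" where
  "observable A \<longleftrightarrow> mat_adjoint A = A"

definition l2_norm :: "complex vec \<Rightarrow> real" where
  "l2_norm v = sqrt (\<Sum>i<dim_vec v. (cmod (v $ i))\<^sup>2)"

definition op_norm :: "complex mat \<Rightarrow> real" where
  "op_norm A = (SUP v\<in>{v \<in> carrier_vec (dim_col A). l2_norm v \<le> 1}. l2_norm (A *\<^sub>v v))"

section \<open>Heisenberg--Weyl expansion\<close>

definition shift_mat :: "nat \<Rightarrow> complex mat" where
  "shift_mat K = mat K K (\<lambda>(i, j). if i = (j + 1) mod K then 1 else 0)"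

definition clock_mat :: "nat \<Rightarrow> complex mat" where
  "clock_mat K = mat K K (\<lambda>(i, j). if i = j then omega K ^ j else 0)"

definition hw_basis :: "nat \<Rightarrow> nat \<Rightarrow> (nat \<Rightarrow> nat) \<Rightarrow> (nat \<Rightarrow> nat) \<Rightarrow> complex mat" where
  "hw_basis K n l m = tensor_mats (\<lambda>j. shift_mat K ^\<^sub>m l j * clock_mat K ^\<^sub>m m j) n"

text \<open>The coefficient family is normalised to vanish off the index set, which makes it unique
  as a total function. The same device is used for \<open>cyc_coeff\<close> below.\<close>

definition hw_coeff ::
  "nat \<Rightarrow> nat \<Rightarrow> complex mat \<Rightarrow> (nat \<Rightarrow> nat) \<times> (nat \<Rightarrow> nat) \<Rightarrow> complex" where
  "hw_coeff K n A = (THE c.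
     (\<forall>lm. lm \<notin> ZK_vec K n \<times> ZK_vec K n \<longrightarrow> c lm = 0) \<and>
     A = mat (K ^ n) (K ^ n)
           (\<lambda>(i, j). \<Sum>(l, m)\<in>ZK_vec K n \<times> ZK_vec K n. c (l, m) * hw_basis K n l m $$ (i, j)))"

definition hw_degree_le :: "nat \<Rightarrow> nat \<Rightarrow> nat \<Rightarrow> complex mat \<Rightarrow> bool" where
  "hw_degree_le K n d A \<longleftrightarrow>
     (\<forall>l\<in>ZK_vec K n. \<forall>m\<in>ZK_vec K n. (\<Sum>j<n. l j + m j) > d \<longrightarrow> hw_coeff K n A (l, m) = 0)"

definition hw_coeff_norm :: "nat \<Rightarrow> nat \<Rightarrow> real \<Rightarrow> complex mat \<Rightarrow> real" where
  "hw_coeff_norm K n p A =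
     (\<Sum>lm\<in>ZK_vec K n \<times> ZK_vec K n. cmod (hw_coeff K n A lm) powr p) powr (1 / p)"

section \<open>Bohnenblust--Hille constant of the cyclic groups\<close>

text \<open>A function on \<open>\<Omega>\<^sub>K\<^sup>N\<close> is a total function of which only the values on
  \<open>Omega_vec K N\<close> matter.\<close>

definition Omega_vec :: "nat \<Rightarrow> nat \<Rightarrow> (nat \<Rightarrow> complex) set" where
  "Omega_vec K N = {..<N} \<rightarrow>\<^sub>E Omega K"

definition cyc_coeff :: "nat \<Rightarrow> nat \<Rightarrow> ((nat \<Rightarrow> complex) \<Rightarrow> complex) \<Rightarrow> (nat \<Rightarrow> nat) \<Rightarrow> complex" where
  "cyc_coeff K N f = (THE c.
     (\<forall>\<alpha>. \<alpha> \<notin> ZK_vec K N \<longrightarrow> c \<alpha> = 0) \<and>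
     (\<forall>z\<in>Omega_vec K N. f z = (\<Sum>\<alpha>\<in>ZK_vec K N. c \<alpha> * (\<Prod>j<N. z j ^ \<alpha> j))))"

definition cyc_degree_le :: "nat \<Rightarrow> nat \<Rightarrow> nat \<Rightarrow> ((nat \<Rightarrow> complex) \<Rightarrow> complex) \<Rightarrow> bool" where
  "cyc_degree_le K N D f \<longleftrightarrow> (\<forall>\<alpha>\<in>ZK_vec K N. (\<Sum>j<N. \<alpha> j) > D \<longrightarrow> cyc_coeff K N f \<alpha> = 0)"

definition cyc_BH_valid :: "nat \<Rightarrow> nat \<Rightarrow> real \<Rightarrow> bool" where
  "cyc_BH_valid K D C \<longleftrightarrow>
     (\<forall>N\<ge>1. \<forall>f. cyc_degree_le K N D f \<longrightarrow>
        (\<Sum>\<alpha>\<in>ZK_vec K N. cmod (cyc_coeff K N f \<alpha>) powr (2 * real D / (real D + 1)))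
            powr ((real D + 1) / (2 * real D))
          \<le> C * (SUP z\<in>Omega_vec K N. cmod (f z)))"

text \<open>The best constant is taken in \<open>ennreal\<close>, so that its meaning does not depend on the
  (true, but deep) fact that the set of valid real constants is nonempty.\<close>

definition BH_Omega :: "nat \<Rightarrow> nat \<Rightarrow> ennreal" where
  "BH_Omega K D = (INF C\<in>{C. C \<ge> 0 \<and> cyc_BH_valid K D C}. ennreal C)"

end

theory Submission
  imports Defs "HOL-Library.Real_Mod" "HOL-Analysis.L2_Norm"
begin

text \<open>
  The operator inequality is transferred to the commutative one by evaluating \<open>A\<close> in a family of
  states indexed by points of a power of \<open>\<Omega>\<close>. Write \<open>\<Sigma>\<close> for the set of coprime pairs and \<open>M\<close> for its
  cardinality.

  If \<open>(l, m)\<close> is coprime, then \<open>U = X\<^sup>l Z\<^sup>m\<close> has \<open>K\<close> distinct eigenvalues, namely a fixed phase times the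
  \<open>K\<close>-th roots of unity \<open>z\<close>. In a unit eigenvector for the eigenvalue that belongs to \<open>z\<close>, the
  expectation of \<open>X\<^sup>l\<^sup>' Z\<^sup>m\<^sup>'\<close> is a phase, independent of \<open>z\<close>, times \<open>z\<^sup>k\<close> if \<open>(l', m')\<close> is \<open>k\<close> times \<open>(l, m)\<close>
  modulo \<open>K\<close>. Otherwise it is zero, because then \<open>U\<close> and \<open>X\<^sup>l\<^sup>' Z\<^sup>m\<^sup>'\<close> commute only up to a nontrivial root
  of unity (lemma \<open>coprime_eigenstates\<close>). Every nonzero pair is a multiple of a coprime one, so the
  average of these expectations over \<open>\<Sigma>\<close>, with one variable for each element of \<open>\<Sigma>\<close>, detects every
  basis element of one tensor factor: a nonzero \<open>(l', m')\<close> becomes a polynomial whose monomials are powers of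
  single variables with coefficients of modulus \<open>1 / M\<close>, and different pairs share no monomial
  (lemma \<open>site_polynomial\<close>).

  Taking products over the tensor factors gives a function \<open>f\<close> of \<open>n * M\<close> roots of unity. Its values
  are averages of expectations of \<open>A\<close> in product unit vectors and are therefore bounded by the operator
  norm. A basis element of degree at most \<open>d\<close> is nontrivial on at most \<open>d\<close> factors. Hence \<open>f\<close> has degree
  at most \<open>(K - 1) * d\<close>, and every coefficient of \<open>A\<close> reappears among the coefficients of \<open>f\<close>, each at its
  own monomial, up to a phase and a divisor of at most \<open>M ^ d\<close> (lemma \<open>transference\<close>). The Bohnenblust--Hille inequality
  for \<open>f\<close> then bounds the coefficients of \<open>A\<close> with the constant \<open>M ^ d * BH\<close>, and \<open>M\<close> is at most \<open>K\<^sup>2\<close>.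
\<close>

section \<open>Characters of the cyclic group\<close>

text \<open>The integer power \<open>omega K powi a\<close>, in a form on which \<open>a\<close> acts additively without any sign
  side conditions. Working with integer exponents removes all reductions modulo \<open>K\<close>.\<close>

definition zeta :: "nat \<Rightarrow> int \<Rightarrow> complex" where
  "zeta K a = cis (2 * pi * of_int a / of_nat K)"

lemma norm_zeta [simp]: "cmod (zeta K a) = 1"
  by (simp add: zeta_def)

lemma zeta_nonzero [simp]: "zeta K a \<noteq> 0"
  using norm_zeta[of K a] by (metis norm_zero zero_neq_one)

lemma zeta_zero [simp]: "zeta K 0 = 1"
  by (simp add: zeta_def)

lemma zeta_add: "zeta K (a + b) = zeta K a * zeta K b"
  by (simp add: zeta_def cis_mult add_divide_distrib ring_distribs)

lemma cnj_zeta: "cnj (zeta K a) = zeta K (- a)"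
  by (simp add: zeta_def cis_cnj)

lemma zeta_power: "zeta K a ^ k = zeta K (a * int k)"
  by (simp add: zeta_def DeMoivre algebra_simps)

lemma omega_power: "omega K ^ k = zeta K (int k)"
proof -
  have "omega K = zeta K 1"
    unfolding omega_def zeta_def cis_conv_exp by (simp add: field_simps)
  thus ?thesis by (simp add: zeta_power)
qed

lemma zeta_eq_1_iff:
  assumes "K > 0"
  shows "zeta K a = 1 \<longleftrightarrow> int K dvd a"
proof -
  have "zeta K a = 1 \<longleftrightarrow> (\<exists>n::int. 2 * pi * of_int a / of_nat K = of_int n * (2 * pi))"
    unfolding zeta_def cis_eq_1_iff by simp
  also have "\<dots> \<longleftrightarrow> (\<exists>n::int. a = int K * n)"
  proof (intro ex_cong1)
    fix n :: int
    have "2 * pi * of_int a / of_nat K = of_int n * (2 * pi) \<longleftrightarrow> (of_int a :: real) = of_nat K * of_int n"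
      using assms by (simp add: field_simps)
    also have "\<dots> \<longleftrightarrow> a = int K * n"
      by (metis of_int_eq_iff of_int_mult of_int_of_nat_eq)
    finally show "2 * pi * of_int a / of_nat K = of_int n * (2 * pi) \<longleftrightarrow> a = int K * n" .
  qed
  finally show ?thesis by (simp add: dvd_def)
qed

lemma zeta_cong:
  assumes "K > 0" "int K dvd a - b"
  shows "zeta K a = zeta K b"
proof -
  have "zeta K (a - b) = 1" using zeta_eq_1_iff assms by blast
  thus ?thesis using zeta_add[of K "a - b" b] by simp
qed

lemma zeta_orthogonality:
  assumes "K > 0"
  shows "(\<Sum>j<K. zeta K (int j * r)) = (if int K dvd r then of_nat K else 0)"
proof (cases "int K dvd r")
  case True
  hence "zeta K (int j * r) = 1" for j using assms by (simp add: zeta_eq_1_iff)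
  thus ?thesis using True by simp
next
  case False
  hence "zeta K r \<noteq> 1" using assms by (simp add: zeta_eq_1_iff)
  moreover have "zeta K r ^ K = 1"
    using assms by (simp add: zeta_power zeta_eq_1_iff)
  ultimately have "(\<Sum>j<K. zeta K r ^ j) = 0"
    by (simp add: geometric_sum)
  thus ?thesis using False by (simp add: zeta_power mult.commute)
qed

lemma int_dvd_diff_iff_eq:
  assumes "a < K" "b < K"
  shows "int K dvd int a - int b \<longleftrightarrow> a = b"
  using assms by (metis mod_eq_dvd_iff of_nat_eq_iff of_nat_mod mod_less)

lemma zeta_orthogonality_nat:
  assumes "a < K" "b < K"
  shows "(\<Sum>j<K. zeta K (int j * (int a - int b))) = (if a = b then of_nat K else 0)"
proof -
  have "K > 0" using assms by auto
  thus ?thesis using zeta_orthogonality int_dvd_diff_iff_eq[OF assms] by presburger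
qed

section \<open>Fourier coefficients on powers of the roots of unity\<close>

lemma finite_ZK_vec [simp]: "finite (ZK_vec K n)"
  by (simp add: ZK_vec_def finite_PiE)

lemma ZK_vec_less: "x \<in> ZK_vec K n \<Longrightarrow> t < n \<Longrightarrow> x t < K"
  by (auto simp: ZK_vec_def PiE_def Pi_def)

text \<open>Distributivity turns every identity for one tensor factor into an identity for \<open>n\<close> factors.\<close>

lemma sum_prod_ZK_vec:
  fixes F :: "nat \<Rightarrow> nat \<Rightarrow> 'a :: comm_semiring_1"
  shows "(\<Sum>x\<in>ZK_vec K n. \<Prod>t<n. F t (x t)) = (\<Prod>t<n. \<Sum>a<K. F t a)"
  unfolding ZK_vec_def by (rule prod_sum_PiE[symmetric]) auto

lemma sum_prod_ZK_vec_pair: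
  fixes F :: "nat \<Rightarrow> nat \<Rightarrow> nat \<Rightarrow> 'a :: comm_semiring_1"
  shows "(\<Sum>(x, y)\<in>ZK_vec K n \<times> ZK_vec K n. \<Prod>t<n. F t (x t) (y t))
           = (\<Prod>t<n. \<Sum>a<K. \<Sum>b<K. F t a b)"
proof -
  have "(\<Sum>y\<in>ZK_vec K n. \<Prod>t<n. F t (x t) (y t)) = (\<Prod>t<n. \<Sum>b<K. F t (x t) b)" for x
    by (rule sum_prod_ZK_vec)
  thus ?thesis
    by (simp add: sum.cartesian_product[symmetric] sum_prod_ZK_vec[where F = "\<lambda>t a. \<Sum>b<K. F t a b"])
qed

lemma ZK_vec_eqI:
  assumes "x \<in> ZK_vec K n" "y \<in> ZK_vec K n" "\<And>t. t < n \<Longrightarrow> x t = y t"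
  shows "x = y"
  using assms unfolding ZK_vec_def by (intro PiE_ext) auto

lemma prod_delta_ZK_vec:
  assumes "x \<in> ZK_vec K n" "y \<in> ZK_vec K n"
  shows "(\<Prod>t<n. if x t = y t then 1 else 0) = (if x = y then 1 else (0 :: 'a :: comm_semiring_1))"
proof (cases "x = y")
  case False
  then obtain t where "t < n" "x t \<noteq> y t" using ZK_vec_eqI[OF assms] by blast
  thus ?thesis using False by (intro trans[OF prod_zero]) auto
qed simp

lemma cyc_coeff_inversion:
  assumes K: "K > 0"
    and f: "\<forall>z\<in>Omega_vec K N. f z = (\<Sum>\<alpha>\<in>ZK_vec K N. c \<alpha> * (\<Prod>j<N. z j ^ \<alpha> j))"
    and \<beta>: "\<beta> \<in> ZK_vec K N"
  shows "c \<beta> = (\<Sum>x\<in>ZK_vec K N. f (\<lambda>j\<in>{..<N}. zeta K (int (x j)))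
                    * (\<Prod>j<N. zeta K (- int (x j) * int (\<beta> j)) / of_nat K))"
proof -
  have mem: "(\<lambda>j\<in>{..<N}. zeta K (int (x j))) \<in> Omega_vec K N" if "x \<in> ZK_vec K N" for x
    using ZK_vec_less[OF that] by (auto simp: Omega_vec_def Omega_def omega_power)
  have fx: "f (\<lambda>j\<in>{..<N}. zeta K (int (x j)))
      = (\<Sum>\<alpha>\<in>ZK_vec K N. c \<alpha> * (\<Prod>j<N. zeta K (int (x j)) ^ \<alpha> j))" if "x \<in> ZK_vec K N" for x
    using f[rule_format, OF mem[OF that]] by simp
  have "(\<Sum>x\<in>ZK_vec K N. f (\<lambda>j\<in>{..<N}. zeta K (int (x j)))
                    * (\<Prod>j<N. zeta K (- int (x j) * int (\<beta> j)) / of_nat K))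
      = (\<Sum>x\<in>ZK_vec K N. \<Sum>\<alpha>\<in>ZK_vec K N. c \<alpha> *
           (\<Prod>j<N. zeta K (int (x j) * (int (\<alpha> j) - int (\<beta> j))) / of_nat K))"
  proof (intro sum.cong refl)
    fix x assume x: "x \<in> ZK_vec K N"
    have "(\<Prod>j<N. zeta K (int (x j)) ^ \<alpha> j) * (\<Prod>j<N. zeta K (- int (x j) * int (\<beta> j)) / of_nat K)
        = (\<Prod>j<N. zeta K (int (x j) * (int (\<alpha> j) - int (\<beta> j))) / of_nat K)" for \<alpha>
      unfolding prod.distrib[symmetric]
      by (intro prod.cong refl) (simp add: zeta_power zeta_add[symmetric] algebra_simps)
    thus "f (\<lambda>j\<in>{..<N}. zeta K (int (x j))) * (\<Prod>j<N. zeta K (- int (x j) * int (\<beta> j)) / of_nat K)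
        = (\<Sum>\<alpha>\<in>ZK_vec K N. c \<alpha> * (\<Prod>j<N. zeta K (int (x j) * (int (\<alpha> j) - int (\<beta> j))) / of_nat K))"
      by (simp add: fx[OF x] sum_distrib_right mult.assoc)
  qed
  also have "\<dots> = (\<Sum>\<alpha>\<in>ZK_vec K N. c \<alpha> * (\<Sum>x\<in>ZK_vec K N.
           (\<Prod>j<N. zeta K (int (x j) * (int (\<alpha> j) - int (\<beta> j))) / of_nat K)))"
    by (subst sum.swap) (simp add: sum_distrib_left)
  also have "\<dots> = (\<Sum>\<alpha>\<in>ZK_vec K N. c \<alpha> * (if \<alpha> = \<beta> then 1 else 0))"
  proof (intro sum.cong refl)
    fix \<alpha> assume \<alpha>: "\<alpha> \<in> ZK_vec K N"
    have "(\<Sum>x\<in>ZK_vec K N. \<Prod>j<N. zeta K (int (x j) * (int (\<alpha> j) - int (\<beta> j))) / of_nat K)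
        = (\<Prod>j<N. \<Sum>a<K. zeta K (int a * (int (\<alpha> j) - int (\<beta> j))) / of_nat K)"
      by (rule sum_prod_ZK_vec)
    also have "\<dots> = (\<Prod>j<N. if \<alpha> j = \<beta> j then 1 else 0)"
      using K by (intro prod.cong refl)
        (simp add: sum_divide_distrib[symmetric] zeta_orthogonality_nat ZK_vec_less[OF \<alpha>] ZK_vec_less[OF \<beta>])
    also have "\<dots> = (if \<alpha> = \<beta> then 1 else 0)" by (rule prod_delta_ZK_vec[OF \<alpha> \<beta>])
    finally show "c \<alpha> * (\<Sum>x\<in>ZK_vec K N. \<Prod>j<N. zeta K (int (x j) * (int (\<alpha> j) - int (\<beta> j))) / of_nat K)
      = c \<alpha> * (if \<alpha> = \<beta> then 1 else 0)" by simp
  qed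
  also have "\<dots> = c \<beta>" using \<beta> by (simp add: if_distrib cong: if_cong)
  finally show ?thesis ..
qed

lemma cyc_coeff_eqI:
  assumes "K > 0"
    and "\<And>z. z \<in> Omega_vec K N \<Longrightarrow> f z = (\<Sum>\<alpha>\<in>ZK_vec K N. c \<alpha> * (\<Prod>j<N. z j ^ \<alpha> j))"
    and "\<alpha> \<in> ZK_vec K N"
  shows "cyc_coeff K N f \<alpha> = c \<alpha>"
proof -
  define c' where "c' \<alpha> = (if \<alpha> \<in> ZK_vec K N then c \<alpha> else 0)" for \<alpha>
  have c': "\<forall>z\<in>Omega_vec K N. f z = (\<Sum>\<alpha>\<in>ZK_vec K N. c' \<alpha> * (\<Prod>j<N. z j ^ \<alpha> j))"
    using assms(2) by (simp add: c'_def)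
  have "cyc_coeff K N f = c'"
    unfolding cyc_coeff_def
  proof (rule the_equality, safe)
    fix c'' \<alpha>
    assume *: "\<forall>\<alpha>. \<alpha> \<notin> ZK_vec K N \<longrightarrow> c'' \<alpha> = 0"
      "\<forall>z\<in>Omega_vec K N. f z = (\<Sum>\<alpha>\<in>ZK_vec K N. c'' \<alpha> * (\<Prod>j<N. z j ^ \<alpha> j))"
    show "c'' = c'"
    proof
      fix \<alpha> show "c'' \<alpha> = c' \<alpha>"
        using cyc_coeff_inversion[OF assms(1) *(2), of \<alpha>] cyc_coeff_inversion[OF assms(1) c', of \<alpha>] *(1)
        by (cases "\<alpha> \<in> ZK_vec K N") (auto simp: c'_def)
    qed
  qed (use c' in \<open>auto simp: c'_def\<close>)
  thus ?thesis using assms(3) by (simp add: c'_def)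
qed

section \<open>The Heisenberg--Weyl basis\<close>

text \<open>The row and column indices of an \<open>n\<close>-fold Kronecker product, read as \<open>n\<close> digits in base \<open>K\<close>.
  The last factor carries the least significant digit.\<close>

primrec digits_value :: "nat \<Rightarrow> nat \<Rightarrow> (nat \<Rightarrow> nat) \<Rightarrow> nat" where
  "digits_value K 0 x = 0"
| "digits_value K (Suc n) x = digits_value K n x * K + x n"

lemma digits_value_less:
  assumes "\<And>t. t < n \<Longrightarrow> x t < K"
  shows "digits_value K n x < K ^ n"
  using assms
proof (induction n)
  case (Suc n)
  have "digits_value K n x + 1 \<le> K ^ n" using Suc by (simp add: Suc_le_eq)
  hence "(digits_value K n x + 1) * K \<le> K ^ n * K" by (rule mult_le_mono1)
  moreover have "x n < K" using Suc.prems by simp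
  ultimately show ?case by (simp add: algebra_simps)
qed simp

lemma digits_value_inject:
  assumes "\<And>t. t < n \<Longrightarrow> x t < K" "\<And>t. t < n \<Longrightarrow> y t < K"
    and "digits_value K n x = digits_value K n y" "t < n"
  shows "x t = y t"
  using assms
proof (induction n)
  case (Suc n)
  have less: "x n < K" "y n < K" using Suc.prems by auto
  have "x n = y n" using arg_cong[OF Suc.prems(3), of "\<lambda>a. a mod K"] less by simp
  moreover from this have "digits_value K n x = digits_value K n y"
    using Suc.prems(3) less by simp
  ultimately show ?case using Suc by (metis less_Suc_eq)
qed simp

lemma bij_betw_digits_value: "bij_betw (digits_value K n) (ZK_vec K n) {..<K ^ n}"
proof -
  have inj: "inj_on (digits_value K n) (ZK_vec K n)"
  proof (rule inj_onI)
    fix x y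
    assume *: "x \<in> ZK_vec K n" "y \<in> ZK_vec K n" "digits_value K n x = digits_value K n y"
    show "x = y"
      by (rule ZK_vec_eqI[OF *(1,2)], rule digits_value_inject[OF _ _ *(3)])
        (use * ZK_vec_less in auto)
  qed
  have "digits_value K n ` ZK_vec K n = {..<K ^ n}"
  proof (rule card_subset_eq)
    show "digits_value K n ` ZK_vec K n \<subseteq> {..<K ^ n}"
    proof (rule image_subsetI)
      fix x assume "x \<in> ZK_vec K n"
      hence "x t < K" if "t < n" for t using that by (rule ZK_vec_less)
      thus "digits_value K n x \<in> {..<K ^ n}" using digits_value_less by simp
    qed
    show "card (digits_value K n ` ZK_vec K n) = card {..<K ^ n}"
      using card_image[OF inj] by (simp add: ZK_vec_def card_PiE)
  qed simp
  thus ?thesis using inj by (simp add: bij_betw_def)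
qed

lemma sum_digits_value: "(\<Sum>i<K ^ n. g i) = (\<Sum>x\<in>ZK_vec K n. g (digits_value K n x))"
  by (rule sum.reindex_bij_betw[OF bij_betw_digits_value, symmetric])

lemma tensor_mats_carrier:
  assumes "\<And>t. t < n \<Longrightarrow> F t \<in> carrier_mat K K"
  shows "tensor_mats F n \<in> carrier_mat (K ^ n) (K ^ n)"
  using assms
proof (induction n)
  case (Suc n)
  hence "tensor_mats F n \<in> carrier_mat (K ^ n) (K ^ n)" "F n \<in> carrier_mat K K" by auto
  thus ?case by (simp add: kronecker_def mult.commute)
qed simp

lemma tensor_mats_entry:
  assumes "\<And>t. t < n \<Longrightarrow> F t \<in> carrier_mat K K"
    and "\<And>t. t < n \<Longrightarrow> x t < K" "\<And>t. t < n \<Longrightarrow> y t < K"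
  shows "tensor_mats F n $$ (digits_value K n x, digits_value K n y) = (\<Prod>t<n. F t $$ (x t, y t))"
  using assms
proof (induction n)
  case (Suc n)
  have carr: "tensor_mats F n \<in> carrier_mat (K ^ n) (K ^ n)" "F n \<in> carrier_mat K K"
    using Suc.prems by (auto intro: tensor_mats_carrier)
  have less: "x n < K" "y n < K" using Suc.prems by auto
  have "digits_value K (Suc n) x < K ^ Suc n" "digits_value K (Suc n) y < K ^ Suc n"
    by (rule digits_value_less; use Suc.prems in blast)+
  hence "tensor_mats F (Suc n) $$ (digits_value K (Suc n) x, digits_value K (Suc n) y)
    = tensor_mats F n $$ (digits_value K n x, digits_value K n y) * F n $$ (x n, y n)"
    using carr less by (simp add: kronecker_def mult.commute)
  also have "tensor_mats F n $$ (digits_value K n x, digits_value K n y) = (\<Prod>t<n. F t $$ (x t, y t))"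
    using Suc by simp
  finally show ?case by simp
qed simp

definition hw_entry :: "nat \<Rightarrow> nat \<Rightarrow> nat \<Rightarrow> nat \<Rightarrow> nat \<Rightarrow> complex" where
  "hw_entry K l m i j = (if i = (j + l) mod K then zeta K (int m * int j) else 0)"

lemma shift_mat_power:
  assumes "K > 0"
  shows "shift_mat K ^\<^sub>m l = mat K K (\<lambda>(i, j). if i = (j + l) mod K then 1 else 0)"
proof (induction l)
  case 0
  show ?case using assms by (intro eq_matI) (auto simp: shift_mat_def)
next
  case (Suc l)
  show ?case
  proof (rule eq_matI)
    fix i j assume "i < dim_row (mat K K (\<lambda>(i, j). if i = (j + Suc l) mod K then 1 else (0 :: complex)))"
      "j < dim_col (mat K K (\<lambda>(i, j). if i = (j + Suc l) mod K then 1 else (0 :: complex)))"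
    hence ij: "i < K" "j < K" by auto
    have "(shift_mat K ^\<^sub>m Suc l) $$ (i, j)
        = (\<Sum>k<K. (if i = (k + l) mod K then 1 else 0) * (if k = (j + 1) mod K then 1 else 0))"
      using ij unfolding pow_mat.simps Suc
      by (simp add: shift_mat_def scalar_prod_def atLeast0LessThan)
    also have "\<dots> = (\<Sum>k<K. if k = (j + 1) mod K then (if i = (k + l) mod K then 1 else 0) else 0)"
      by (intro sum.cong) auto
    also have "\<dots> = (if i = (j + Suc l) mod K then 1 else 0)"
      using assms by (simp add: mod_simps)
    finally show "(shift_mat K ^\<^sub>m Suc l) $$ (i, j)
      = mat K K (\<lambda>(i, j). if i = (j + Suc l) mod K then 1 else (0 :: complex)) $$ (i, j)"
      using ij by simp
  qed (simp_all add: Suc shift_mat_def)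
qed

lemma clock_mat_power:
  "clock_mat K ^\<^sub>m m = mat K K (\<lambda>(i, j). if i = j then zeta K (int m * int j) else 0)"
proof (induction m)
  case 0
  show ?case by (intro eq_matI) (auto simp: clock_mat_def)
next
  case (Suc m)
  show ?case
  proof (rule eq_matI)
    fix i j assume "i < dim_row (mat K K (\<lambda>(i, j). if i = j then zeta K (int (Suc m) * int j) else 0))"
      "j < dim_col (mat K K (\<lambda>(i, j). if i = j then zeta K (int (Suc m) * int j) else 0))"
    hence ij: "i < K" "j < K" by auto
    have "(clock_mat K ^\<^sub>m Suc m) $$ (i, j)
        = (\<Sum>k<K. (if i = k then zeta K (int m * int k) else 0) * (if k = j then zeta K (int j) else 0))"
      using ij unfolding pow_mat.simps Suc
      by (simp add: clock_mat_def[unfolded omega_power] scalar_prod_def atLeast0LessThan)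
    also have "\<dots> = (\<Sum>k<K. if k = j then (if i = j then zeta K (int m * int j) * zeta K (int j) else 0) else 0)"
      by (intro sum.cong) auto
    also have "\<dots> = (if i = j then zeta K (int (Suc m) * int j) else 0)"
      using ij by (simp add: zeta_add[symmetric] algebra_simps)
    finally show "(clock_mat K ^\<^sub>m Suc m) $$ (i, j)
      = mat K K (\<lambda>(i, j). if i = j then zeta K (int (Suc m) * int j) else 0) $$ (i, j)"
      using ij by simp
  qed (simp_all add: Suc clock_mat_def)
qed

lemma shift_clock_entry:
  assumes "i < K" "j < K"
  shows "(shift_mat K ^\<^sub>m l * clock_mat K ^\<^sub>m m) $$ (i, j) = hw_entry K l m i j"
proof -
  have "(shift_mat K ^\<^sub>m l * clock_mat K ^\<^sub>m m) $$ (i, j)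
     = (\<Sum>k<K. (if i = (k + l) mod K then 1 else 0) * (if k = j then zeta K (int m * int j) else 0))"
    using assms by (simp add: shift_mat_power clock_mat_power scalar_prod_def atLeast0LessThan)
  also have "\<dots> = (\<Sum>k<K. if k = j then hw_entry K l m i j else 0)"
    by (intro sum.cong) (auto simp: hw_entry_def)
  finally show ?thesis using assms by simp
qed

lemma shift_clock_carrier:
  "K > 0 \<Longrightarrow> shift_mat K ^\<^sub>m l * clock_mat K ^\<^sub>m m \<in> carrier_mat K K"
  by (auto simp: shift_mat_power clock_mat_power intro!: mult_carrier_mat)

lemma hw_basis_entry:
  assumes "K > 0" "x \<in> ZK_vec K n" "y \<in> ZK_vec K n"
  shows "hw_basis K n l m $$ (digits_value K n x, digits_value K n y)
           = (\<Prod>t<n. hw_entry K (l t) (m t) (x t) (y t))"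
  unfolding hw_basis_def using assms
  by (subst tensor_mats_entry[where K = K])
    (auto simp: shift_clock_entry shift_clock_carrier ZK_vec_less intro!: prod.cong)

text \<open>Up to conjugation and the factor \<open>1 / K\<close>, a basis matrix is its own dual, because the basis is
  orthogonal for the trace inner product and every element has squared norm \<open>K\<close>.\<close>

definition hw_dual_entry :: "nat \<Rightarrow> nat \<Rightarrow> nat \<Rightarrow> nat \<Rightarrow> nat \<Rightarrow> complex" where
  "hw_dual_entry K l m i j = (if i = (j + l) mod K then zeta K (- int m * int j) / of_nat K else 0)"

lemma add_mod_inject:
  fixes j l l' :: nat
  assumes "l < K" "l' < K"
  shows "(j + l) mod K = (j + l') mod K \<longleftrightarrow> l = l'"
proof -
  have "(j + l) mod K = (j + l') mod K \<longleftrightarrow> int (j + l) mod int K = int (j + l') mod int K"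
    by (metis of_nat_mod of_nat_eq_iff)
  also have "\<dots> \<longleftrightarrow> int K dvd int (j + l) - int (j + l')" by (rule mod_eq_dvd_iff)
  also have "\<dots> \<longleftrightarrow> l = l'" using int_dvd_diff_iff_eq[OF assms] by simp
  finally show ?thesis .
qed

lemma hw_complete:
  assumes "i < K" "j < K" "i' < K" "j' < K"
  shows "(\<Sum>l<K. \<Sum>m<K. hw_dual_entry K l m i j * hw_entry K l m i' j')
           = (if i = i' then 1 else 0) * (if j = j' then 1 else 0)"
proof -
  have K: "K > 0" using assms by simp
  have "(\<Sum>l<K. \<Sum>m<K. hw_dual_entry K l m i j * hw_entry K l m i' j')
      = (\<Sum>l<K. (if i = (j + l) mod K \<and> i' = (j' + l) mod K
           then \<Sum>m<K. zeta K (int m * (int j' - int j)) / of_nat K else 0))"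
    by (intro sum.cong refl)
      (auto simp: hw_dual_entry_def hw_entry_def zeta_add[symmetric] algebra_simps)
  also have "\<dots> = (\<Sum>l<K. if i = (j + l) mod K \<and> i' = (j' + l) mod K \<and> j = j' then 1 else 0)"
    using K by (intro sum.cong refl)
      (simp add: sum_divide_distrib[symmetric] zeta_orthogonality_nat assms)
  also have "\<dots> = (\<Sum>l<K. if l = (i + (K - j)) mod K then (if i = i' \<and> j = j' then 1 else 0) else 0)"
  proof (intro sum.cong refl)
    fix l assume "l \<in> {..<K}"
    hence l: "l < K" by simp
    have "i = (j + l) mod K \<longleftrightarrow> l = (i + (K - j)) mod K"
    proof
      assume "i = (j + l) mod K"
      hence "(i + (K - j)) mod K = (j + l + (K - j)) mod K" by (simp add: mod_simps)
      also have "j + l + (K - j) = l + K" using assms by simp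
      finally show "l = (i + (K - j)) mod K" using l by simp
    next
      assume "l = (i + (K - j)) mod K"
      hence "(j + l) mod K = (j + (i + (K - j))) mod K" by (simp add: mod_simps)
      also have "j + (i + (K - j)) = i + K" using assms by simp
      finally show "i = (j + l) mod K" using assms by simp
    qed
    thus "(if i = (j + l) mod K \<and> i' = (j' + l) mod K \<and> j = j' then 1 else 0) =
        (if l = (i + (K - j)) mod K then (if i = i' \<and> j = j' then 1 else (0 :: complex)) else 0)"
      by auto
  qed
  also have "\<dots> = (if i = i' then 1 else 0) * (if j = j' then 1 else 0)" using K by simp
  finally show ?thesis .
qed

lemma hw_biorthogonal:
  assumes "l < K" "m < K" "l' < K" "m' < K"
  shows "(\<Sum>i<K. \<Sum>j<K. hw_entry K l m i j * hw_dual_entry K l' m' i j)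
           = (if l = l' then 1 else 0) * (if m = m' then 1 else 0)"
proof -
  have K: "K > 0" using assms by simp
  have "(\<Sum>i<K. \<Sum>j<K. hw_entry K l m i j * hw_dual_entry K l' m' i j)
      = (\<Sum>j<K. \<Sum>i<K. if i = (j + l) mod K then
           (if l = l' then zeta K (int j * (int m - int m')) / of_nat K else 0) else 0)"
    by (subst sum.swap, intro sum.cong refl)
      (auto simp: hw_dual_entry_def hw_entry_def zeta_add[symmetric] algebra_simps
        add_mod_inject[OF assms(1,3)])
  also have "\<dots> = (\<Sum>j<K. if l = l' then zeta K (int j * (int m - int m')) / of_nat K else 0)"
    using K by (intro sum.cong refl) simp
  also have "\<dots> = (if l = l' then 1 else 0) * (if m = m' then 1 else 0)"
    using K by (simp add: sum_divide_distrib[symmetric] zeta_orthogonality_nat assms)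
  finally show ?thesis .
qed

text \<open>The site-wise identities multiply up to \<open>n\<close> sites, so that the coefficient family asked for by
  \<open>hw_coeff\<close> exists, by completeness, and is unique, by biorthogonality.\<close>

lemma hw_expansion:
  assumes K: "K > 0" and x: "x \<in> ZK_vec K n" and y: "y \<in> ZK_vec K n"
    and A: "A \<in> carrier_mat (K ^ n) (K ^ n)"
  shows "A $$ (digits_value K n x, digits_value K n y)
    = (\<Sum>(l, m)\<in>ZK_vec K n \<times> ZK_vec K n. hw_coeff K n A (l, m) *
         (\<Prod>t<n. hw_entry K (l t) (m t) (x t) (y t)))"
proof -
  let ?V = "ZK_vec K n" and ?e = "digits_value K n"
  let ?B = "\<lambda>l m x y. \<Prod>t<n. hw_entry K (l t) (m t) (x t) (y t)"
  let ?D = "\<lambda>l m x y. \<Prod>t<n. hw_dual_entry K (l t) (m t) (x t) (y t)"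
  let ?supp = "\<lambda>c. \<forall>lm. lm \<notin> ?V \<times> ?V \<longrightarrow> c lm = 0"
  let ?expands = "\<lambda>c. A = mat (K ^ n) (K ^ n)
           (\<lambda>(i, j). \<Sum>(l, m)\<in>?V \<times> ?V. c (l, m) * hw_basis K n l m $$ (i, j))"
  have e_less: "?e x < K ^ n" if "x \<in> ?V" for x
    by (rule digits_value_less) (rule ZK_vec_less[OF that])
  have e_ex: "\<exists>x\<in>?V. i = ?e x" if "i < K ^ n" for i
    using bij_betw_digits_value[of K n] that by (auto simp: bij_betw_def set_eq_iff image_iff)
  have expands_iff: "?expands c \<longleftrightarrow> (\<forall>x\<in>?V. \<forall>y\<in>?V. A $$ (?e x, ?e y) =
      (\<Sum>(l, m)\<in>?V \<times> ?V. c (l, m) * ?B l m x y))" (is "_ \<longleftrightarrow> ?entries c") for c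
  proof
    assume *: "?expands c"
    show "?entries c"
      by (intro ballI, subst *)
        (auto simp: e_less hw_basis_entry[OF K] intro!: sum.cong)
  next
    assume *: "?entries c"
    show "?expands c"
    proof (rule eq_matI)
      fix i j
      assume "i < dim_row (mat (K ^ n) (K ^ n)
           (\<lambda>(i, j). \<Sum>(l, m)\<in>?V \<times> ?V. c (l, m) * hw_basis K n l m $$ (i, j)))"
        "j < dim_col (mat (K ^ n) (K ^ n)
           (\<lambda>(i, j). \<Sum>(l, m)\<in>?V \<times> ?V. c (l, m) * hw_basis K n l m $$ (i, j)))"
      hence ij: "i < K ^ n" "j < K ^ n" by auto
      then obtain x y where "x \<in> ?V" "y \<in> ?V" "i = ?e x" "j = ?e y" using e_ex by meson
      thus "A $$ (i, j) = mat (K ^ n) (K ^ n)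
           (\<lambda>(i, j). \<Sum>(l, m)\<in>?V \<times> ?V. c (l, m) * hw_basis K n l m $$ (i, j)) $$ (i, j)"
        using * ij by (auto simp: hw_basis_entry[OF K] intro!: sum.cong)
    qed (use A in auto)
  qed
  define c0 where "c0 = (\<lambda>(l, m). if (l, m) \<in> ?V \<times> ?V then
      \<Sum>(x, y)\<in>?V \<times> ?V. A $$ (?e x, ?e y) * ?D l m x y else 0)"
  have c0: "?expands c0"
    unfolding expands_iff
  proof (intro ballI)
    fix x' y' assume x': "x' \<in> ?V" and y': "y' \<in> ?V"
    have "(\<Sum>(l, m)\<in>?V \<times> ?V. c0 (l, m) * ?B l m x' y')
        = (\<Sum>p\<in>?V \<times> ?V. \<Sum>q\<in>?V \<times> ?V. A $$ (?e (fst q), ?e (snd q)) *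
            (?D (fst p) (snd p) (fst q) (snd q) * ?B (fst p) (snd p) x' y'))"
      by (intro sum.cong) (auto simp: c0_def sum_distrib_right mult.assoc case_prod_beta)
    also have "\<dots> = (\<Sum>q\<in>?V \<times> ?V. A $$ (?e (fst q), ?e (snd q)) *
            (\<Sum>p\<in>?V \<times> ?V. ?D (fst p) (snd p) (fst q) (snd q) * ?B (fst p) (snd p) x' y'))"
      by (subst sum.swap) (simp add: sum_distrib_left)
    also have "\<dots> = (\<Sum>q\<in>?V \<times> ?V. A $$ (?e (fst q), ?e (snd q)) * (if q = (x', y') then 1 else 0))"
    proof (intro sum.cong refl arg_cong[where f = "(*) _"])
      fix q assume "q \<in> ?V \<times> ?V"
      then obtain x y where q: "q = (x, y)" and x: "x \<in> ?V" and y: "y \<in> ?V" by auto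
      have "(\<Sum>p\<in>?V \<times> ?V. ?D (fst p) (snd p) x y * ?B (fst p) (snd p) x' y')
          = (\<Sum>(l, m)\<in>?V \<times> ?V. \<Prod>t<n. hw_dual_entry K (l t) (m t) (x t) (y t)
                * hw_entry K (l t) (m t) (x' t) (y' t))"
        by (simp add: prod.distrib case_prod_beta)
      also have "\<dots> = (\<Prod>t<n. \<Sum>l<K. \<Sum>m<K. hw_dual_entry K l m (x t) (y t) * hw_entry K l m (x' t) (y' t))"
        by (rule sum_prod_ZK_vec_pair)
      also have "\<dots> = (\<Prod>t<n. (if x t = x' t then 1 else 0) * (if y t = y' t then 1 else 0))"
        by (intro prod.cong refl hw_complete) (use x y x' y' ZK_vec_less in auto)
      also have "\<dots> = (if q = (x', y') then 1 else 0)"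
        using x y x' y' q by (simp add: prod.distrib prod_delta_ZK_vec)
      finally show "(\<Sum>p\<in>?V \<times> ?V. ?D (fst p) (snd p) (fst q) (snd q) * ?B (fst p) (snd p) x' y')
        = (if q = (x', y') then 1 else 0)" by (simp add: q)
    qed
    also have "\<dots> = A $$ (?e x', ?e y')" using x' y' by (simp add: if_distrib cong: if_cong)
    finally show "A $$ (?e x', ?e y') = (\<Sum>(l, m)\<in>?V \<times> ?V. c0 (l, m) * ?B l m x' y')" ..
  qed
  have supp: "?supp c0" by (auto simp: c0_def)
  have unique: "c = c0" if "?supp c" "?expands c" for c
  proof
    fix lm
    show "c lm = c0 lm"
    proof (cases "lm \<in> ?V \<times> ?V")
      case True
      then obtain l m where lm: "lm = (l, m)" and l: "l \<in> ?V" and m: "m \<in> ?V" by auto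
      have "c0 (l, m) = (\<Sum>q\<in>?V \<times> ?V. \<Sum>p\<in>?V \<times> ?V. c p *
            (?B (fst p) (snd p) (fst q) (snd q) * ?D l m (fst q) (snd q)))"
        using that(2) l m unfolding expands_iff
        by (auto simp: c0_def sum_distrib_right mult.assoc case_prod_beta intro!: sum.cong)
      also have "\<dots> = (\<Sum>p\<in>?V \<times> ?V. c p *
            (\<Sum>q\<in>?V \<times> ?V. ?B (fst p) (snd p) (fst q) (snd q) * ?D l m (fst q) (snd q)))"
        by (subst sum.swap) (simp add: sum_distrib_left)
      also have "\<dots> = (\<Sum>p\<in>?V \<times> ?V. c p * (if p = (l, m) then 1 else 0))"
      proof (intro sum.cong refl arg_cong[where f = "(*) _"])
        fix p assume "p \<in> ?V \<times> ?V"
        then obtain l' m' where p: "p = (l', m')" and l': "l' \<in> ?V" and m': "m' \<in> ?V" by auto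
        have "(\<Sum>q\<in>?V \<times> ?V. ?B l' m' (fst q) (snd q) * ?D l m (fst q) (snd q))
            = (\<Sum>(x, y)\<in>?V \<times> ?V. \<Prod>t<n. hw_entry K (l' t) (m' t) (x t) (y t)
                * hw_dual_entry K (l t) (m t) (x t) (y t))"
          by (simp add: prod.distrib case_prod_beta)
        also have "\<dots> = (\<Prod>t<n. \<Sum>i<K. \<Sum>j<K. hw_entry K (l' t) (m' t) i j * hw_dual_entry K (l t) (m t) i j)"
          by (rule sum_prod_ZK_vec_pair)
        also have "\<dots> = (\<Prod>t<n. (if l' t = l t then 1 else 0) * (if m' t = m t then 1 else 0))"
          by (intro prod.cong refl hw_biorthogonal) (use l m l' m' ZK_vec_less in auto)
        also have "\<dots> = (if p = (l, m) then 1 else 0)"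
          using l m l' m' p by (simp add: prod.distrib prod_delta_ZK_vec)
        finally show "(\<Sum>q\<in>?V \<times> ?V. ?B (fst p) (snd p) (fst q) (snd q) * ?D l m (fst q) (snd q))
          = (if p = (l, m) then 1 else 0)" by (simp add: p)
      qed
      also have "\<dots> = c (l, m)" using l m by (simp add: if_distrib cong: if_cong)
      finally show ?thesis by (simp add: lm)
    qed (use that(1) supp in metis)
  qed
  have "hw_coeff K n A = c0"
    unfolding hw_coeff_def
  proof (rule the_equality)
    show "?supp c0 \<and> ?expands c0" using supp c0 by blast
    show "c = c0" if "?supp c \<and> ?expands c" for c using unique that by blast
  qed
  thus ?thesis using c0 x y unfolding expands_iff by simp
qed

section \<open>Expectations in product states\<close>

definition hw_expect :: "nat \<Rightarrow> (nat \<Rightarrow> complex) \<Rightarrow> nat \<Rightarrow> nat \<Rightarrow> complex" where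
  "hw_expect K w l m = (\<Sum>i<K. \<Sum>j<K. cnj (w i) * hw_entry K l m i j * w j)"

lemma Cauchy_Schwarz_cnj:
  "cmod (\<Sum>i<N. cnj (u i) * v i) \<le> sqrt (\<Sum>i<N. (cmod (u i))\<^sup>2) * sqrt (\<Sum>i<N. (cmod (v i))\<^sup>2)"
proof -
  have "cmod (\<Sum>i<N. cnj (u i) * v i) \<le> (\<Sum>i<N. \<bar>cmod (u i)\<bar> * \<bar>cmod (v i)\<bar>)"
    by (rule order_trans[OF norm_sum]) (simp add: norm_mult)
  also have "\<dots> \<le> L2_set (\<lambda>i. cmod (u i)) {..<N} * L2_set (\<lambda>i. cmod (v i)) {..<N}"
    by (rule L2_set_mult_ineq)
  finally show ?thesis by (simp add: L2_set_def)
qed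

text \<open>The supremum that defines \<open>op_norm\<close> is over a bounded set, so every unit vector gives a
  lower bound for it.\<close>

lemma l2_norm_mult_le_op_norm:
  assumes A: "A \<in> carrier_mat N N" and v: "v \<in> carrier_vec N" "l2_norm v \<le> 1"
  shows "l2_norm (A *\<^sub>v v) \<le> op_norm A"
proof -
  have "l2_norm (A *\<^sub>v u) \<le> (\<Sum>i<N. \<Sum>j<N. cmod (A $$ (i, j)))"
    if u: "u \<in> carrier_vec N" "l2_norm u \<le> 1" for u
  proof -
    have le1: "cmod (u $ j) \<le> 1" if "j < N" for j
    proof -
      have "cmod (u $ j) = sqrt ((cmod (u $ j))\<^sup>2)" by simp
      also have "\<dots> \<le> l2_norm u"
        unfolding l2_norm_def real_sqrt_le_iff using that u(1)
        by (intro member_le_sum[where f = "\<lambda>i. (cmod (u $ i))\<^sup>2"]) auto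
      finally show ?thesis using u(2) by simp
    qed
    have "l2_norm (A *\<^sub>v u) = L2_set (\<lambda>i. cmod ((A *\<^sub>v u) $ i)) {..<N}"
      using A by (simp add: l2_norm_def L2_set_def)
    also have "\<dots> \<le> (\<Sum>i<N. cmod ((A *\<^sub>v u) $ i))"
      by (rule L2_set_le_sum) simp
    also have "\<dots> \<le> (\<Sum>i<N. \<Sum>j<N. cmod (A $$ (i, j)))"
    proof (rule sum_mono)
      fix i assume "i \<in> {..<N}"
      hence "(A *\<^sub>v u) $ i = (\<Sum>j<N. A $$ (i, j) * u $ j)"
        using A u(1) by (simp add: scalar_prod_def atLeast0LessThan)
      also have "cmod \<dots> \<le> (\<Sum>j<N. cmod (A $$ (i, j)))"
        by (rule sum_norm_le) (simp add: norm_mult le1 mult_left_le)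
      finally show "cmod ((A *\<^sub>v u) $ i) \<le> (\<Sum>j<N. cmod (A $$ (i, j)))" .
    qed
    finally show ?thesis .
  qed
  hence "bdd_above ((\<lambda>u. l2_norm (A *\<^sub>v u)) ` {u \<in> carrier_vec N. l2_norm u \<le> 1})"
    by (intro bdd_aboveI) blast
  thus ?thesis unfolding op_norm_def using A v by (intro cSUP_upper) auto
qed

lemma quadratic_form_le_op_norm:
  assumes A: "A \<in> carrier_mat N N" and u: "(\<Sum>i<N. (cmod (u i))\<^sup>2) = 1"
  shows "cmod (\<Sum>i<N. \<Sum>j<N. cnj (u i) * A $$ (i, j) * u j) \<le> op_norm A"
proof -
  have u': "vec N u \<in> carrier_vec N" "l2_norm (vec N u) = 1"
    using u by (auto simp: l2_norm_def)
  have "(\<Sum>i<N. \<Sum>j<N. cnj (u i) * A $$ (i, j) * u j) = (\<Sum>i<N. cnj (u i) * (A *\<^sub>v vec N u) $ i)"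
    using A by (intro sum.cong) (auto simp: scalar_prod_def sum_distrib_left mult.assoc atLeast0LessThan)
  also have "cmod \<dots> \<le> sqrt (\<Sum>i<N. (cmod (u i))\<^sup>2) * sqrt (\<Sum>i<N. (cmod ((A *\<^sub>v vec N u) $ i))\<^sup>2)"
    by (rule Cauchy_Schwarz_cnj)
  also have "\<dots> = l2_norm (A *\<^sub>v vec N u)" using A u by (simp add: l2_norm_def)
  also have "\<dots> \<le> op_norm A" by (rule l2_norm_mult_le_op_norm[OF A]) (use u' in auto)
  finally show ?thesis .
qed

text \<open>In a product state the expectation of a tensor product factorizes, so the expectation of \<open>A\<close>
  is read off from its Heisenberg--Weyl expansion.\<close>

lemma product_state_expectation_le_op_norm:
  assumes K: "K > 0" and A: "A \<in> carrier_mat (K ^ n) (K ^ n)"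
    and w: "\<And>t. t < n \<Longrightarrow> (\<Sum>i<K. (cmod (w t i))\<^sup>2) = 1"
  shows "cmod (\<Sum>(l, m)\<in>ZK_vec K n \<times> ZK_vec K n. hw_coeff K n A (l, m) *
           (\<Prod>t<n. hw_expect K (w t) (l t) (m t))) \<le> op_norm A"
proof -
  let ?V = "ZK_vec K n" and ?e = "digits_value K n"
  define u where "u i = (\<Prod>t<n. w t (inv_into ?V ?e i t))" for i
  have u: "u (?e x) = (\<Prod>t<n. w t (x t))" if "x \<in> ?V" for x
    using that bij_betw_digits_value[of K n] by (simp add: u_def bij_betw_def inv_into_f_f)
  have "(\<Sum>i<K ^ n. (cmod (u i))\<^sup>2) = (\<Sum>x\<in>?V. \<Prod>t<n. (cmod (w t (x t)))\<^sup>2)"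
    unfolding sum_digits_value
    by (intro sum.cong) (simp_all add: u prod_norm[symmetric] prod_power_distrib)
  also have "\<dots> = (\<Prod>t<n. \<Sum>i<K. (cmod (w t i))\<^sup>2)" by (rule sum_prod_ZK_vec)
  also have "\<dots> = 1" using w by simp
  finally have norm: "(\<Sum>i<K ^ n. (cmod (u i))\<^sup>2) = 1" .
  have "(\<Sum>i<K ^ n. \<Sum>j<K ^ n. cnj (u i) * A $$ (i, j) * u j)
      = (\<Sum>q\<in>?V \<times> ?V. cnj (u (?e (fst q))) * A $$ (?e (fst q), ?e (snd q)) * u (?e (snd q)))"
    unfolding sum_digits_value by (simp add: sum.cartesian_product case_prod_beta)
  also have "\<dots> = (\<Sum>q\<in>?V \<times> ?V. \<Sum>p\<in>?V \<times> ?V. hw_coeff K n A p *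
        (\<Prod>t<n. cnj (w t (fst q t)) * hw_entry K (fst p t) (snd p t) (fst q t) (snd q t) * w t (snd q t)))"
    by (intro sum.cong refl)
      (auto simp: u hw_expansion[OF K _ _ A] sum_distrib_left sum_distrib_right prod.distrib
        case_prod_beta mult_ac intro!: sum.cong)
  also have "\<dots> = (\<Sum>p\<in>?V \<times> ?V. hw_coeff K n A p * (\<Sum>q\<in>?V \<times> ?V.
        (\<Prod>t<n. cnj (w t (fst q t)) * hw_entry K (fst p t) (snd p t) (fst q t) (snd q t) * w t (snd q t))))"
    by (subst sum.swap) (simp add: sum_distrib_left)
  also have "\<dots> = (\<Sum>(l, m)\<in>?V \<times> ?V. hw_coeff K n A (l, m) *
           (\<Prod>t<n. hw_expect K (w t) (l t) (m t)))"
  proof (intro sum.cong refl)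
    fix p assume "p \<in> ?V \<times> ?V"
    have "(\<Sum>q\<in>?V \<times> ?V. \<Prod>t<n. cnj (w t (fst q t)) *
            hw_entry K (fst p t) (snd p t) (fst q t) (snd q t) * w t (snd q t))
        = (\<Prod>t<n. hw_expect K (w t) (fst p t) (snd p t))"
      unfolding hw_expect_def sum_prod_ZK_vec_pair[symmetric] by (simp add: case_prod_beta)
    thus "hw_coeff K n A p * (\<Sum>q\<in>?V \<times> ?V. \<Prod>t<n. cnj (w t (fst q t)) *
            hw_entry K (fst p t) (snd p t) (fst q t) (snd q t) * w t (snd q t))
        = (case p of (l, m) \<Rightarrow> hw_coeff K n A (l, m) * (\<Prod>t<n. hw_expect K (w t) (l t) (m t)))"
      by (simp add: case_prod_beta)
  qed
  finally show ?thesis using quadratic_form_le_op_norm[OF A norm] by simp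
qed

section \<open>Eigenvectors of coprime basis elements\<close>

text \<open>Vectors are extended to \<open>K\<close>-periodic functions on the integers, where the shift is a
  translation.\<close>

definition periodic :: "nat \<Rightarrow> (int \<Rightarrow> complex) \<Rightarrow> bool" where
  "periodic K w \<longleftrightarrow> (\<forall>i. w (i + int K) = w i)"

lemma periodic_cong:
  assumes w: "periodic K w" and "int K dvd i - j"
  shows "w i = w j"
proof -
  have nat_multiple: "w (i + int K * int k) = w i" for i k
  proof (induction k)
    case (Suc k)
    have "w (i + int K * int (Suc k)) = w ((i + int K * int k) + int K)" by (simp add: algebra_simps)
    thus ?case using w Suc by (simp add: periodic_def)
  qed simp
  obtain k where k: "i = j + int K * k" using assms(2) by (metis dvdE add.commute diff_add_cancel)
  show ?thesis
  proof (cases "k \<ge> 0")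
    case True
    thus ?thesis using nat_multiple[of j "nat k"] k by simp
  next
    case False
    thus ?thesis using nat_multiple[of i "nat (- k)"] k by simp
  qed
qed

lemma sum_periodic_shift:
  assumes K: "K > 0" and g: "periodic K g"
  shows "(\<Sum>j<K. g (int j + a)) = (\<Sum>j<K. g (int j))"
proof (rule sum.reindex_bij_witness[where i = "\<lambda>j. nat ((int j - a) mod int K)"
      and j = "\<lambda>j. nat ((int j + a) mod int K)"])
  fix j assume j: "j \<in> {..<K}"
  show "nat ((int (nat ((int j + a) mod int K)) - a) mod int K) = j"
    "nat ((int (nat ((int j - a) mod int K)) + a) mod int K) = j"
    using K j by (simp_all add: mod_simps)
  show "nat ((int j + a) mod int K) \<in> {..<K}" "nat ((int j - a) mod int K) \<in> {..<K}"
    using K by (simp_all add: nat_less_iff)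
  have "int K dvd int (nat ((int j + a) mod int K)) - (int j + a)"
    using K by (simp add: mod_eq_dvd_iff[symmetric])
  thus "g (int (nat ((int j + a) mod int K))) = g (int j + a)" by (rule periodic_cong[OF g])
qed

text \<open>The operator \<open>(U v) (i + l) = zeta K (m * i) * v i\<close> satisfies \<open>U\<^sup>K = \<theta>\<close> for a phase \<open>\<theta>\<close>. Hence,
  for every \<open>K\<close>-th root \<open>\<lambda>\<close> of \<open>\<theta>\<close>, the average of \<open>\<lambda>\<^sup>-\<^sup>k U\<^sup>k\<close> maps into the \<open>\<lambda>\<close>-eigenspace. These
  projections sum to the identity over all roots, so one of them does not kill the delta function.\<close>

lemma weyl_eigenvector:
  assumes K: "K > 0"
  obtains w \<mu> where "periodic K w" "cmod \<mu> = 1"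
    "\<And>i. w (i + l) = \<mu> * zeta K (m * i) * w i" "(\<Sum>j<K. (cmod (w (int j)))\<^sup>2) = 1"
proof -
  define \<delta> :: "int \<Rightarrow> complex" where "\<delta> i = (if int K dvd i then 1 else 0)" for i
  define U :: "(int \<Rightarrow> complex) \<Rightarrow> int \<Rightarrow> complex" where
    "U v i = zeta K (m * (i - l)) * v (i - l)" for v i
  define h where "h k = (U ^^ k) \<delta>" for k
  have h_Suc: "h (Suc k) i = zeta K (m * (i - l)) * h k (i - l)" for k i
    by (simp add: h_def U_def)
  have h_explicit: "\<exists>\<theta>. cmod \<theta> = 1 \<and> (\<forall>i. h k i = \<theta> * zeta K (m * int k * i) * \<delta> (i - int k * l))" for k
  proof (induction k)
    case 0
    show ?case by (intro exI[of _ 1]) (simp add: h_def)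
  next
    case (Suc k)
    then obtain \<theta> where \<theta>: "cmod \<theta> = 1" "\<And>i. h k i = \<theta> * zeta K (m * int k * i) * \<delta> (i - int k * l)"
      by blast
    have "h (Suc k) i = \<theta> * zeta K (- m * int (Suc k) * l) * zeta K (m * int (Suc k) * i)
            * \<delta> (i - int (Suc k) * l)" for i
    proof -
      have "h (Suc k) i = \<theta> * (zeta K (m * (i - l)) * zeta K (m * int k * (i - l))) * \<delta> (i - l - int k * l)"
        by (simp add: h_Suc \<theta>(2) mult_ac)
      also have "zeta K (m * (i - l)) * zeta K (m * int k * (i - l))
          = zeta K (- m * int (Suc k) * l) * zeta K (m * int (Suc k) * i)"
        unfolding zeta_add[symmetric] by (simp add: algebra_simps)
      also have "i - l - int k * l = i - int (Suc k) * l" by (simp add: algebra_simps)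
      finally show ?thesis by (simp only: mult.assoc)
    qed
    thus ?case using \<theta>(1) by (intro exI[of _ "\<theta> * zeta K (- m * int (Suc k) * l)"]) (simp add: norm_mult)
  qed
  have h_periodic: "periodic K (h k)" for k
  proof -
    obtain \<theta> where \<theta>: "\<And>i. h k i = \<theta> * zeta K (m * int k * i) * \<delta> (i - int k * l)"
      using h_explicit by blast
    have "zeta K (m * int k * (i + int K)) = zeta K (m * int k * i)" for i
      by (rule zeta_cong[OF K]) (simp add: algebra_simps)
    moreover have "\<delta> (i + int K - int k * l) = \<delta> (i - int k * l)" for i
      unfolding \<delta>_def by (metis add_diff_eq diff_add_eq dvd_add_triv_right_iff)
    ultimately show ?thesis by (simp add: periodic_def \<theta>)
  qed
  obtain \<theta> where \<theta>: "cmod \<theta> = 1" "\<And>i. h K i = \<theta> * h 0 i"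
  proof -
    obtain \<theta> where \<theta>: "cmod \<theta> = 1" "\<And>i. h K i = \<theta> * zeta K (m * int K * i) * \<delta> (i - int K * l)"
      using h_explicit by blast
    have "zeta K (m * int K * i) = 1" for i using K by (simp add: zeta_eq_1_iff)
    moreover have "\<delta> (i - int K * l) = \<delta> i" for i
      unfolding \<delta>_def by (metis dvd_triv_left dvd_diff_left_iff)
    ultimately show ?thesis using that[of \<theta>] \<theta> by (simp add: h_def)
  qed
  define \<nu> where "\<nu> = cis (Arg \<theta> / of_nat K)"
  have \<nu>: "cmod \<nu> = 1" "\<nu> ^ K = \<theta>"
    using K \<theta>(1) rcis_cmod_Arg[of \<theta>] by (simp_all add: \<nu>_def DeMoivre rcis_def)
  define w where "w t i = (\<Sum>k<K. inverse (\<nu> * zeta K (int t)) ^ k * h k i)" for t i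
  have eigen: "zeta K (m * i) * w t i = (\<nu> * zeta K (int t)) * w t (i + l)" for t i
  proof -
    let ?\<kappa> = "\<nu> * zeta K (int t)"
    have nz: "?\<kappa> \<noteq> 0" using \<nu> by auto
    have "?\<kappa> ^ K = \<theta>" using K by (simp add: power_mult_distrib \<nu> zeta_power zeta_eq_1_iff)
    moreover have "inverse ?\<kappa> ^ K * ?\<kappa> ^ K = 1"
      unfolding power_mult_distrib[symmetric] left_inverse[OF nz] by simp
    ultimately have wrap: "inverse ?\<kappa> ^ K * h K (i + l) = h 0 (i + l)"
      using \<theta>(2) by (metis mult.assoc mult_1)
    have "zeta K (m * i) * w t i = (\<Sum>k<K. inverse ?\<kappa> ^ k * h (Suc k) (i + l))"
      by (simp add: w_def sum_distrib_left h_Suc mult_ac)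
    also have "\<dots> = ?\<kappa> * (\<Sum>k<K. inverse ?\<kappa> ^ Suc k * h (Suc k) (i + l))"
      unfolding sum_distrib_left by (intro sum.cong refl) (use nz in \<open>simp add: field_simps\<close>)
    also have "(\<Sum>k<K. inverse ?\<kappa> ^ Suc k * h (Suc k) (i + l)) = w t (i + l)"
      using sum.lessThan_Suc_shift[of "\<lambda>k. inverse ?\<kappa> ^ k * h k (i + l)" K] wrap
      by (simp add: w_def)
    finally show ?thesis .
  qed
  have "(\<Sum>t<K. w t 0) = (\<Sum>k<K. inverse \<nu> ^ k * h k 0 * (\<Sum>t<K. zeta K (int t * (int 0 - int k))))"
  proof -
    have "inverse (\<nu> * zeta K (int t)) ^ k = inverse \<nu> ^ k * zeta K (int t * (int 0 - int k))" for t k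
    proof -
      have "inverse (zeta K (int t)) = zeta K (- int t)"
        using zeta_add[of K "int t" "- int t"] by (simp add: inverse_eq_divide field_simps)
      thus ?thesis by (simp add: power_mult_distrib zeta_power)
    qed
    thus ?thesis unfolding w_def sum_distrib_left by (subst sum.swap) (simp add: mult_ac)
  qed
  also have "\<dots> = (\<Sum>k<K. if k = 0 then of_nat K else 0)"
    using K by (intro sum.cong refl) (simp add: zeta_orthogonality_nat h_def \<delta>_def del: of_nat_0)
  also have "\<dots> \<noteq> 0" using K by simp
  finally obtain t where t: "w t 0 \<noteq> 0" by (metis (no_types, lifting) sum.neutral)
  define N where "N = (\<Sum>j<K. (cmod (w t (int j)))\<^sup>2)"
  have "(cmod (w t (int 0)))\<^sup>2 \<le> N"
    unfolding N_def using K by (intro member_le_sum[where f = "\<lambda>j. (cmod (w t (int j)))\<^sup>2"]) auto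
  moreover have "0 < (cmod (w t (int 0)))\<^sup>2" using t by simp
  ultimately have N: "N > 0" by linarith
  show ?thesis
  proof (rule that[of "\<lambda>i. w t i / of_real (sqrt N)" "inverse (\<nu> * zeta K (int t))"])
    show "periodic K (\<lambda>i. w t i / of_real (sqrt N))"
      using h_periodic by (simp add: periodic_def w_def)
    show "cmod (inverse (\<nu> * zeta K (int t))) = 1" using \<nu> by (simp add: norm_mult norm_inverse)
    show "w t (i + l) / of_real (sqrt N) = inverse (\<nu> * zeta K (int t)) * zeta K (m * i) *
        (w t i / of_real (sqrt N))" for i
      using eigen[of i t] \<nu>(1) by (auto simp: field_simps)
    show "(\<Sum>j<K. (cmod (w t (int j) / of_real (sqrt N)))\<^sup>2) = 1"
      using N by (simp add: norm_divide power_divide sum_divide_distrib[symmetric] N_def[symmetric])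
  qed
qed

lemma hw_expect_periodic:
  assumes K: "K > 0" and w: "periodic K w"
  shows "hw_expect K (\<lambda>i. w (int i)) l m
    = (\<Sum>j<K. cnj (w (int j + int l)) * zeta K (int m * int j) * w (int j))"
proof -
  have "hw_expect K (\<lambda>i. w (int i)) l m
      = (\<Sum>j<K. \<Sum>i<K. if i = (j + l) mod K
           then cnj (w (int i)) * zeta K (int m * int j) * w (int j) else 0)"
    unfolding hw_expect_def hw_entry_def by (subst sum.swap) (intro sum.cong refl, auto)
  also have "\<dots> = (\<Sum>j<K. cnj (w (int ((j + l) mod K))) * zeta K (int m * int j) * w (int j))"
    using K by simp
  also have "\<dots> = (\<Sum>j<K. cnj (w (int j + int l)) * zeta K (int m * int j) * w (int j))"
  proof -
    have "w (int ((j + l) mod K)) = w (int j + int l)" for j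
      by (rule periodic_cong[OF w]) (simp add: zmod_int mod_eq_dvd_iff[symmetric])
    thus ?thesis by simp
  qed
  finally show ?thesis .
qed

text \<open>Coprimality enters only through the Bezout coefficients \<open>a\<close> and \<open>b\<close> modulo \<open>K\<close>. An element \<open>(l', m')\<close> that is no multiple
  of \<open>(l, m)\<close> fails to commute with it by a nontrivial root of unity, so its expectation in an
  eigenvector of \<open>(l, m)\<close> is zero, whereas \<open>k\<close> times \<open>(l, m)\<close> acts on this eigenvector as a scalar.
  Translating the eigenvector by \<open>t * b\<close> and modulating it by \<open>- t * a\<close> multiplies the \<open>k\<close>-th scalar by
  the \<open>k\<close>-th power of the root of unity \<open>zeta K t\<close> and thus reaches all \<open>K\<close> eigenvalues, while the
  phases \<open>\<phi>\<close> stay the same.\<close>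

lemma coprime_eigenstates:
  assumes K: "K > 0" and bezout: "int K dvd a * l + b * m - 1"
  obtains \<phi> w where "\<And>k. cmod (\<phi> k) = 1"
    "\<And>t. (\<Sum>i<K. (cmod (w t i))\<^sup>2) = 1"
    "\<And>t l' m'. hw_expect K (w t) l' m' =
       (\<Sum>k<K. if int K dvd int k * l - int l' \<and> int K dvd int k * m - int m'
                then \<phi> k * zeta K (int t * int k) else 0)"
proof -
  obtain v \<mu> where v: "periodic K v" "cmod \<mu> = 1" "\<And>i. v (i + l) = \<mu> * zeta K (m * i) * v i"
    and norm_v: "(\<Sum>j<K. (cmod (v (int j)))\<^sup>2) = 1"
    using weyl_eigenvector[OF K, of l m] by metis
  have norm_v_complex: "(\<Sum>j<K. complex_of_real ((cmod (v (int j)))\<^sup>2)) = 1"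
    using norm_v by (metis of_real_1 of_real_sum)
  define G where "G l' m' i = cnj (v (i + l')) * zeta K (m' * i) * v i" for l' m' i
  define E where "E l' m' = (\<Sum>j<K. G l' m' (int j))" for l' m'
  have G_periodic: "periodic K (G l' m')" for l' m'
  proof -
    have "zeta K (m' * (i + int K)) = zeta K (m' * i)" for i
      by (rule zeta_cong[OF K]) (simp add: algebra_simps)
    moreover have "v (i + int K + l') = v (i + l')" for i by (rule periodic_cong[OF v(1)]) simp
    moreover have "v (i + int K) = v i" for i by (rule periodic_cong[OF v(1)]) simp
    ultimately show ?thesis by (simp add: periodic_def G_def)
  qed
  have E_cong: "E l' m' = E l'' m''" if "int K dvd l' - l''" "int K dvd m' - m''" for l' l'' m' m''
  proof -
    have "v (i + l') = v (i + l'')" for i by (rule periodic_cong[OF v(1)]) (use that in simp)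
    moreover have "zeta K (m' * i) = zeta K (m'' * i)" for i
      by (rule zeta_cong[OF K]) (metis that(2) dvd_mult2 left_diff_distrib)
    ultimately show ?thesis by (simp add: E_def G_def)
  qed
  have \<mu>\<mu>: "cnj \<mu> * \<mu> = 1" using v(2) by (metis complex_norm_square mult.commute of_real_1 power_one)
  have E_zero: "E l' m' = 0" if "\<not> int K dvd m' * l - m * l'" for l' m'
  proof -
    have "G l' m' (i + l) = zeta K (m' * l - m * l') * G l' m' i" for i
    proof -
      have "v (i + l + l') = \<mu> * zeta K (m * (i + l')) * v (i + l')"
        using v(3)[of "i + l'"] by (simp add: algebra_simps)
      hence "G l' m' (i + l) = (cnj \<mu> * \<mu>) * (zeta K (- (m * (i + l'))) * zeta K (m' * (i + l)) * zeta K (m * i))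
          * (cnj (v (i + l')) * v i)"
        by (simp add: G_def v(3) cnj_zeta mult_ac)
      also have "zeta K (- (m * (i + l'))) * zeta K (m' * (i + l)) * zeta K (m * i)
          = zeta K (m' * l - m * l') * zeta K (m' * i)"
        unfolding zeta_add[symmetric] by (simp add: algebra_simps)
      finally show ?thesis unfolding \<mu>\<mu> by (simp add: G_def mult_ac)
    qed
    hence "E l' m' = zeta K (m' * l - m * l') * E l' m'"
      using sum_periodic_shift[OF K G_periodic, of l' m' l] by (simp add: E_def sum_distrib_left)
    moreover have "zeta K (m' * l - m * l') \<noteq> 1" using that K by (simp add: zeta_eq_1_iff)
    ultimately show ?thesis by (metis mult_cancel_right1)
  qed
  have E_multiple: "cmod (E (int k * l) (int k * m)) = 1" for k
  proof -
    have "\<exists>\<theta>. cmod \<theta> = 1 \<and> (\<forall>i. v (i + int k * l) = \<theta> * zeta K (m * int k * i) * v i)"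
    proof (induction k)
      case 0
      show ?case by (intro exI[of _ 1]) simp
    next
      case (Suc k)
      then obtain \<theta> where \<theta>: "cmod \<theta> = 1" "\<And>i. v (i + int k * l) = \<theta> * zeta K (m * int k * i) * v i"
        by blast
      have "v (i + int (Suc k) * l) = (\<theta> * \<mu> * zeta K (m * int k * l)) * zeta K (m * int (Suc k) * i) * v i" for i
      proof -
        have "v (i + int (Suc k) * l) = v ((i + l) + int k * l)" by (simp add: algebra_simps)
        also have "\<dots> = \<theta> * \<mu> * (zeta K (m * int k * (i + l)) * zeta K (m * i)) * v i"
          unfolding \<theta>(2) v(3) by (simp add: mult_ac)
        also have "zeta K (m * int k * (i + l)) * zeta K (m * i) = zeta K (m * int k * l) * zeta K (m * int (Suc k) * i)"
          unfolding zeta_add[symmetric] by (simp add: algebra_simps)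
        finally show ?thesis by (simp add: mult_ac)
      qed
      thus ?case using \<theta>(1) v(2)
        by (intro exI[of _ "\<theta> * \<mu> * zeta K (m * int k * l)"]) (simp add: norm_mult)
    qed
    then obtain \<theta> where \<theta>: "cmod \<theta> = 1" "\<And>i. v (i + int k * l) = \<theta> * zeta K (m * int k * i) * v i"
      by blast
    have "G (int k * l) (int k * m) i = cnj \<theta> * of_real ((cmod (v i))\<^sup>2)" for i
    proof -
      have "G (int k * l) (int k * m) i
          = cnj \<theta> * (zeta K (- (m * int k * i)) * zeta K (int k * m * i)) * (v i * cnj (v i))"
        unfolding G_def \<theta>(2) by (simp add: cnj_zeta mult_ac)
      also have "zeta K (- (m * int k * i)) * zeta K (int k * m * i) = 1"
        unfolding zeta_add[symmetric] by (simp add: algebra_simps)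
      finally show ?thesis by (simp add: complex_norm_square[symmetric])
    qed
    hence "E (int k * l) (int k * m) = cnj \<theta> * (\<Sum>j<K. of_real ((cmod (v (int j)))\<^sup>2))"
      unfolding E_def sum_distrib_left by (simp only:)
    hence "E (int k * l) (int k * m) = cnj \<theta>" by (simp only: norm_v_complex mult_1_right)
    thus ?thesis using \<theta>(1) by simp
  qed
  define w where "w t i = zeta K (- int t * a * i) * v (i - int t * b)" for t :: nat and i
  have w_periodic: "periodic K (w t)" for t
  proof -
    have "zeta K (- int t * a * (i + int K)) = zeta K (- int t * a * i)" for i
      by (rule zeta_cong[OF K]) (simp add: algebra_simps)
    moreover have "v (i + int K - int t * b) = v (i - int t * b)" for i
      by (rule periodic_cong[OF v(1)]) simp
    ultimately show ?thesis by (simp add: periodic_def w_def)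
  qed
  have norm_w: "(\<Sum>j<K. (cmod (w t (int j)))\<^sup>2) = 1" for t
  proof -
    have "periodic K (\<lambda>i. of_real ((cmod (v i))\<^sup>2))"
      using v(1) by (simp add: periodic_def)
    from sum_periodic_shift[OF K this, of "- int t * b"]
    have "complex_of_real (\<Sum>j<K. (cmod (v (int j + - int t * b)))\<^sup>2) = 1"
      unfolding of_real_sum by (simp only: norm_v_complex)
    hence "(\<Sum>j<K. (cmod (v (int j + - int t * b)))\<^sup>2) = 1"
      by (simp only: of_real_eq_1_iff)
    thus ?thesis by (simp add: w_def norm_mult)
  qed
  have expect_w: "hw_expect K (\<lambda>i. w t (int i)) l' m' = zeta K (int t * (a * int l' + b * int m')) * E (int l') (int m')"
    for t l' m'
  proof -
    have "cnj (w t (i + int l')) * zeta K (int m' * i) * w t i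
        = zeta K (int t * (a * int l' + b * int m')) * G (int l') (int m') (i + - int t * b)" for i
    proof -
      have "cnj (w t (i + int l')) * zeta K (int m' * i) * w t i
          = (zeta K (int t * a * (i + int l')) * zeta K (int m' * i) * zeta K (- int t * a * i))
             * (cnj (v (i - int t * b + int l')) * v (i - int t * b))"
        by (simp add: w_def cnj_zeta algebra_simps)
      also have "zeta K (int t * a * (i + int l')) * zeta K (int m' * i) * zeta K (- int t * a * i)
          = zeta K (int t * (a * int l' + b * int m')) * zeta K (int m' * (i - int t * b))"
        unfolding zeta_add[symmetric] by (simp add: algebra_simps)
      finally show ?thesis by (simp add: G_def mult_ac)
    qed
    thus ?thesis
      using sum_periodic_shift[OF K G_periodic, of "int l'" "int m'" "- int t * b"]
      by (simp add: hw_expect_periodic[OF K w_periodic] E_def sum_distrib_left[symmetric])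
  qed
  have expect_formula: "hw_expect K (\<lambda>i. w t (int i)) l' m' =
       (\<Sum>k<K. if int K dvd int k * l - int l' \<and> int K dvd int k * m - int m'
                then E (int k * l) (int k * m) * zeta K (int t * int k) else 0)" (is "_ = (\<Sum>k<K. if ?c k then _ else _)")
    for t l' m'
  proof -
    \<comment> \<open>the only candidate for the multiple, since \<open>a\<close> and \<open>b\<close> invert multiplication by \<open>(l, m)\<close>\<close>
    define k0 where "k0 = nat ((a * int l' + b * int m') mod int K)"
    have k0: "k0 < K" "int k0 = (a * int l' + b * int m') mod int K"
      using K by (simp_all add: k0_def nat_less_iff)
    have k0_cong: "int K dvd int k0 - (a * int l' + b * int m')"
      by (simp add: k0(2) mod_eq_dvd_iff[symmetric])
    have unique: "k = k0" if "k < K" "?c k" for k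
    proof -
      have "int k - int k0 = - (int k * (a * l + b * m - 1)) + a * (int k * l - int l') + b * (int k * m - int m')
          - (int k0 - (a * int l' + b * int m'))"
        by (simp add: algebra_simps)
      also have "int K dvd \<dots>"
        using that(2) k0_cong bezout
        by (intro dvd_diff[OF dvd_add[OF dvd_add] k0_cong] iffD2[OF dvd_minus_iff] dvd_mult) auto
      finally show ?thesis using int_dvd_diff_iff_eq[OF that(1) k0(1)] by simp
    qed
    have "(\<Sum>k<K. if ?c k then E (int k * l) (int k * m) * zeta K (int t * int k) else 0)
        = (\<Sum>k<K. if k = k0 then (if ?c k0 then E (int k0 * l) (int k0 * m) * zeta K (int t * int k0) else 0) else 0)"
    proof (intro sum.cong refl)
      fix k assume "k \<in> {..<K}"
      show "(if ?c k then E (int k * l) (int k * m) * zeta K (int t * int k) else 0) =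
        (if k = k0 then (if ?c k0 then E (int k0 * l) (int k0 * m) * zeta K (int t * int k0) else 0) else 0)"
      proof (cases "k = k0")
        case False
        hence "\<not> ?c k" using unique \<open>k \<in> {..<K}\<close> by blast
        thus ?thesis using False by (simp only: if_False)
      qed simp
    qed
    also have "\<dots> = (if ?c k0 then E (int k0 * l) (int k0 * m) * zeta K (int t * int k0) else 0)"
      using k0(1) by simp
    also have "\<dots> = hw_expect K (\<lambda>i. w t (int i)) l' m'"
    proof (cases "?c k0")
      case True
      have "E (int k0 * l) (int k0 * m) = E (int l') (int m')" using True by (intro E_cong) auto
      moreover have "zeta K (int t * int k0) = zeta K (int t * (a * int l' + b * int m'))"
        by (rule zeta_cong[OF K]) (metis k0_cong dvd_mult right_diff_distrib)
      ultimately show ?thesis using True by (simp add: expect_w)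
    next
      case False
      have "\<not> int K dvd int m' * l - m * int l'"
      proof
        assume *: "int K dvd int m' * l - m * int l'"
        have "int k0 * l - int l' = l * (int k0 - (a * int l' + b * int m')) + int l' * (a * l + b * m - 1)
            + b * (int m' * l - m * int l')" by (simp add: algebra_simps)
        also have "int K dvd \<dots>"
          by (rule dvd_add[OF dvd_add]; rule dvd_mult) (fact k0_cong bezout *)+
        finally have 1: "int K dvd int k0 * l - int l'" .
        have "int k0 * m - int m' = m * (int k0 - (a * int l' + b * int m')) + int m' * (a * l + b * m - 1)
            - a * (int m' * l - m * int l')" by (simp add: algebra_simps)
        also have "int K dvd \<dots>"
          by (rule dvd_diff[OF dvd_add]; rule dvd_mult) (fact k0_cong bezout *)+
        finally show False using 1 False by blast
      qed
      hence "E (int l') (int m') = 0" by (rule E_zero)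
      thus ?thesis using False by (simp only: expect_w if_False mult_zero_right)
    qed
    finally show ?thesis ..
  qed
  show ?thesis
    by (rule that[of "\<lambda>k. E (int k * l) (int k * m)" "\<lambda>t i. w t (int i)"])
      (use E_multiple norm_w expect_formula in auto)
qed

section \<open>Coprime pairs and one tensor factor\<close>

lemma ZK_rep_cong: "int K dvd int (ZK_rep K l) - int l"
  by (simp add: ZK_rep_def)

lemma Sigma_K_bezout:
  assumes "(l, m) \<in> Sigma_K K"
  obtains a b where "int K dvd a * int l + b * int m - 1"
proof -
  have "coprime (int (ZK_rep K l)) (int (ZK_rep K m))"
    using assms by (simp add: Sigma_K_def)
  then obtain a b where ab: "a * int (ZK_rep K l) + b * int (ZK_rep K m) = 1"
    using bezout_int[of "int (ZK_rep K l)" "int (ZK_rep K m)"] by auto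
  have "a * int l + b * int m - 1
      = - (a * (int (ZK_rep K l) - int l)) - b * (int (ZK_rep K m) - int m)"
    using ab by (simp add: algebra_simps)
  also have "int K dvd \<dots>"
    by (rule dvd_diff; (rule iffD2[OF dvd_minus_iff])?; rule dvd_mult; rule ZK_rep_cong)
  finally show ?thesis by (rule that)
qed

text \<open>Divide the representatives of \<open>l'\<close> and \<open>m'\<close> by their greatest common divisor. That the
  representatives lie in \<open>{1..K}\<close> makes this work even if one of the two is zero modulo \<open>K\<close>.\<close>

lemma Sigma_K_multiples:
  assumes "l' < K" "m' < K" "(l', m') \<noteq> (0, 0)"
  obtains l m k where "(l, m) \<in> Sigma_K K" "0 < k" "k < K"
    "int K dvd int k * int l - int l'" "int K dvd int k * int m - int m'"
proof -
  define g where "g = gcd (ZK_rep K l') (ZK_rep K m')"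
  define l where "l = ZK_rep K l' div g"
  define m where "m = ZK_rep K m' div g"
  have K: "K > 0" using assms by simp
  have rep: "0 < ZK_rep K x" "ZK_rep K x \<le> K" if "x < K" for x
    using that by (auto simp: ZK_rep_def)
  have g: "g > 0" using rep assms by (simp add: g_def)
  have lm: "ZK_rep K l' = g * l" "ZK_rep K m' = g * m" by (simp_all add: l_def m_def g_def)
  hence pos: "0 < l" "0 < m" using rep assms by (metis mult_0_right neq0_conv)+
  have le: "l \<le> K" "m \<le> K"
    using rep(2) assms by (auto simp: l_def m_def intro: order_trans[OF div_le_dividend])
  have rep_mod: "ZK_rep K (x mod K) = x" if "0 < x" "x \<le> K" for x
    using that by (cases "x = K") (auto simp: ZK_rep_def)
  have "coprime l m" unfolding l_def m_def g_def
    using rep assms by (intro div_gcd_coprime) auto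
  hence mem: "(l mod K, m mod K) \<in> Sigma_K K"
    using K rep_mod pos le by (simp add: Sigma_K_def)
  have "ZK_rep K l' < K \<or> ZK_rep K m' < K" using assms by (auto simp: ZK_rep_def)
  moreover have "g \<le> ZK_rep K l'" "g \<le> ZK_rep K m'" using lm pos by simp_all
  ultimately have "g < K" by linarith
  have multiple: "int K dvd int g * int (x mod K) - int x'" if "ZK_rep K x' = g * x" for x x'
  proof -
    have "int g * int (x mod K) - int x' = - (int g * (int x - int (x mod K))) + (int (ZK_rep K x') - int x')"
      by (simp add: that algebra_simps)
    also have "int K dvd \<dots>"
      by (rule dvd_add[OF _ ZK_rep_cong], rule iffD2[OF dvd_minus_iff], rule dvd_mult)
        (simp add: zmod_int mod_eq_dvd_iff[symmetric])
    finally show ?thesis .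
  qed
  show ?thesis by (rule that[OF mem g \<open>g < K\<close> multiple[OF lm(1)] multiple[OF lm(2)]])
qed

lemma Sigma_K_subset: "Sigma_K K \<subseteq> {..<K} \<times> {..<K}"
  by (auto simp: Sigma_K_def)

lemma finite_Sigma_K [simp]: "finite (Sigma_K K)"
  by (rule finite_subset[OF Sigma_K_subset]) simp

lemma card_Sigma_K_le: "card (Sigma_K K) \<le> K\<^sup>2"
  using card_mono[OF _ Sigma_K_subset, of K] by (simp add: power2_eq_square)

lemma card_Sigma_K_pos:
  assumes "K \<ge> 2"
  shows "card (Sigma_K K) > 0"
proof -
  have "(1, 1) \<in> Sigma_K K" using assms by (auto simp: Sigma_K_def ZK_rep_def)
  thus ?thesis by (auto simp: card_gt_0_iff)
qed

lemma hw_expect_0_0: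
  "hw_expect K w 0 0 = of_real (\<Sum>i<K. (cmod (w i))\<^sup>2)"
proof -
  have "hw_expect K w 0 0 = (\<Sum>i<K. \<Sum>j<K. if i = j then w i * cnj (w i) else 0)"
    unfolding hw_expect_def by (intro sum.cong refl) (auto simp: hw_entry_def)
  also have "\<dots> = (\<Sum>i<K. w i * cnj (w i))" by (intro sum.cong) auto
  also have "\<dots> = of_real (\<Sum>i<K. (cmod (w i))\<^sup>2)"
    unfolding of_real_sum by (simp only: complex_norm_square)
  finally show ?thesis .
qed

text \<open>The polynomial that one tensor factor contributes. Averaging over \<open>\<Sigma>\<close> the eigenstates of its
  elements, where the eigenvalue for the \<open>s\<close>-th element is indexed by the variable \<open>y s\<close>, the
  expectation of the basis element \<open>p\<close> becomes a polynomial in \<open>y\<close> with coefficients \<open>\<gamma> p\<close>. It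
  is constant for \<open>p = (0, 0)\<close>, and for other \<open>p\<close> its monomials are the powers \<open>y s ^ k\<close> for which \<open>p\<close> is \<open>k\<close> times the \<open>s\<close>-th element of \<open>\<Sigma>\<close>. Hence a
  monomial determines \<open>p\<close>, and \<open>\<mu> p\<close> is any one of the monomials of \<open>p\<close>.\<close>

lemma site_polynomial:
  assumes K: "K \<ge> 2" and M_def: "M = card (Sigma_K K)"
  obtains \<gamma> :: "nat \<times> nat \<Rightarrow> (nat \<Rightarrow> nat) \<Rightarrow> complex"
    and \<mu> :: "nat \<times> nat \<Rightarrow> nat \<Rightarrow> nat"
    and w :: "nat \<Rightarrow> nat \<Rightarrow> nat \<Rightarrow> complex"
  where
    "\<And>s \<tau>. s < M \<Longrightarrow> (\<Sum>i<K. (cmod (w s \<tau> i))\<^sup>2) = 1"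
    "\<And>l m \<tau>. l < K \<Longrightarrow> m < K \<Longrightarrow>
       (\<Sum>s<M. hw_expect K (w s (\<tau> s)) l m) / of_nat M
         = (\<Sum>a\<in>ZK_vec K M. \<gamma> (l, m) a * (\<Prod>s<M. zeta K (int (\<tau> s)) ^ a s))"
    "\<And>p q a. p \<in> {..<K} \<times> {..<K} \<Longrightarrow> q \<in> {..<K} \<times> {..<K} \<Longrightarrow> \<gamma> p a \<noteq> 0 \<Longrightarrow> \<gamma> q a \<noteq> 0 \<Longrightarrow> p = q"
    "\<And>p. p \<in> {..<K} \<times> {..<K} \<Longrightarrow> \<mu> p \<in> ZK_vec K M"
    "\<And>p. p \<in> {..<K} \<times> {..<K} \<Longrightarrow>
       cmod (\<gamma> p (\<mu> p)) = (if p = (0, 0) then 1 else 1 / of_nat M)"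
    "\<And>p a. \<gamma> p a \<noteq> 0 \<Longrightarrow> (\<Sum>s<M. a s) \<le> (if p = (0, 0) then 0 else K - 1)"
proof -
  have K0: "K > 0" using K by simp
  have M: "M > 0" using card_Sigma_K_pos[OF K] M_def by simp
  obtain h where h: "bij_betw h {..<M} (Sigma_K K)"
    using ex_bij_betw_nat_finite[OF finite_Sigma_K, of K] unfolding M_def atLeast0LessThan by blast
  define hits where "hits s k p \<longleftrightarrow> int K dvd int k * int (fst (h s)) - int (fst p) \<and>
      int K dvd int k * int (snd (h s)) - int (snd p)" for s k and p :: "nat \<times> nat"
  define eigen where "eigen s \<phi> w \<longleftrightarrow> (\<forall>k. cmod (\<phi> k) = 1) \<and> (\<forall>t. (\<Sum>i<K. (cmod (w t i))\<^sup>2) = 1) \<and>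
      (\<forall>t l' m'. hw_expect K (w t) l' m' =
         (\<Sum>k<K. if hits s k (l', m') then \<phi> k * zeta K (int t * int k) else 0))" for s \<phi> w
  have "\<exists>\<phi> w. eigen s \<phi> w" if s: "s < M" for s
  proof -
    have "h s \<in> Sigma_K K" using h s by (auto simp: bij_betw_def)
    hence "(fst (h s), snd (h s)) \<in> Sigma_K K" by simp
    then obtain a b where bezout: "int K dvd a * int (fst (h s)) + b * int (snd (h s)) - 1"
      by (rule Sigma_K_bezout)
    obtain \<phi> w where "\<And>k. cmod (\<phi> k) = 1" "\<And>t. (\<Sum>i<K. (cmod (w t i))\<^sup>2) = 1"
      "\<And>t l' m'. hw_expect K (w t) l' m' =
         (\<Sum>k<K. if int K dvd int k * int (fst (h s)) - int l' \<and> int K dvd int k * int (snd (h s)) - int m'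
                  then \<phi> k * zeta K (int t * int k) else 0)"
      by (rule coprime_eigenstates[OF K0 bezout]) (rule that)
    thus ?thesis unfolding eigen_def hits_def fst_conv snd_conv by (intro exI[of _ \<phi>] exI[of _ w] conjI allI)
  qed
  then obtain \<phi> w where "\<And>s. s < M \<Longrightarrow> eigen s (\<phi> s) (w s)" by metis
  hence \<phi>: "\<And>s k. s < M \<Longrightarrow> cmod (\<phi> s k) = 1"
    and w: "\<And>s t. s < M \<Longrightarrow> (\<Sum>i<K. (cmod (w s t i))\<^sup>2) = 1"
    and expect: "\<And>s t l' m'. s < M \<Longrightarrow> hw_expect K (w s t) l' m' =
         (\<Sum>k<K. if hits s k (l', m') then \<phi> s k * zeta K (int t * int k) else 0)"
    unfolding eigen_def by blast+
  define single where "single s k = (\<lambda>r\<in>{..<M}. if r = s then k else 0)" for s k :: nat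
  have single_apply: "single s k s = k" if "s < M" for s k using that by (simp add: single_def)
  have single_mem: "single s k \<in> ZK_vec K M" if "k < K" for s k
    using that by (auto simp: single_def ZK_vec_def)
  have single_inject: "s = s' \<and> k = k'" if "single s k = single s' k'" "s < M" "0 < k" for s s' k k'
  proof -
    have "single s' k' s = k" using that single_apply by metis
    thus ?thesis using that(2,3) by (auto simp: single_def split: if_splits)
  qed
  have sum_single: "(\<Sum>r<M. single s k r) = k" if "s < M" for s k
    using that by (simp add: single_def)
  have prod_single: "(\<Prod>r<M. y r ^ single s k r) = y s ^ k" if "s < M" for s k and y :: "nat \<Rightarrow> complex"
  proof -
    have "(\<Prod>r<M. y r ^ single s k r) = (\<Prod>r<M. if r = s then y s ^ k else 1)"
      by (intro prod.cong) (auto simp: single_def)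
    thus ?thesis using that by simp
  qed
  define \<gamma> where "\<gamma> p a = (if p = (0, 0) then (if a = single 0 0 then 1 else 0)
      else \<Sum>s<M. \<Sum>k\<in>{1..<K}. if hits s k p \<and> a = single s k then \<phi> s k / of_nat M else 0)"
    for p :: "nat \<times> nat" and a
  have \<gamma>_nonzero: "\<exists>s k. s < M \<and> 0 < k \<and> k < K \<and> hits s k p \<and> a = single s k"
    if "\<gamma> p a \<noteq> 0" "p \<noteq> (0, 0)" for p a
  proof -
    have "(\<Sum>s<M. \<Sum>k\<in>{1..<K}. if hits s k p \<and> a = single s k then \<phi> s k / of_nat M else 0) \<noteq> 0"
      using that by (simp add: \<gamma>_def)
    then obtain s where s: "s \<in> {..<M}"
        "(\<Sum>k\<in>{1..<K}. if hits s k p \<and> a = single s k then \<phi> s k / of_nat M else 0) \<noteq> 0"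
      by (rule sum.not_neutral_contains_not_neutral)
    from s(2) obtain k where "k \<in> {1..<K}"
        "(if hits s k p \<and> a = single s k then \<phi> s k / of_nat M else 0) \<noteq> 0"
      by (rule sum.not_neutral_contains_not_neutral)
    hence "s < M \<and> 0 < k \<and> k < K \<and> hits s k p \<and> a = single s k"
      using s(1) by (auto split: if_splits)
    thus ?thesis by blast
  qed
  have \<gamma>_zero_nonzero: "a = single 0 0" if "\<gamma> (0, 0) a \<noteq> 0" for a
    using that by (simp add: \<gamma>_def split: if_splits)
  have single_zero: "single s k \<noteq> single 0 0" if "s < M" "0 < k" for s k
    using single_inject[of s k 0 0] that by auto
  have hits_inject: "p = q" if "hits s k p" "hits s k q" "p \<in> {..<K} \<times> {..<K}" "q \<in> {..<K} \<times> {..<K}" for s k p q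
  proof -
    have *: "x = y" if "int K dvd c - int x" "int K dvd c - int y" "x < K" "y < K" for c x y
    proof -
      have "int K dvd (c - int y) - (c - int x)" by (rule dvd_diff[OF that(2,1)])
      thus ?thesis using int_dvd_diff_iff_eq[OF that(3,4)] by simp
    qed
    show ?thesis using that * unfolding hits_def by (auto simp: prod_eq_iff)
  qed
  have "\<exists>s k. s < M \<and> 0 < k \<and> k < K \<and> hits s k p" if p: "p \<in> {..<K} \<times> {..<K}" "p \<noteq> (0, 0)" for p
  proof -
    obtain l m k where lmk: "(l, m) \<in> Sigma_K K" "0 < k" "k < K"
      "int K dvd int k * int l - int (fst p)" "int K dvd int k * int m - int (snd p)"
      by (rule Sigma_K_multiples[where K = K and l' = "fst p" and m' = "snd p"]) (use p in \<open>auto simp: prod_eq_iff\<close>)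
    hence "(l, m) \<in> h ` {..<M}" using h by (simp add: bij_betw_def)
    then obtain s where "s < M" "h s = (l, m)" by (metis imageE lessThan_iff)
    thus ?thesis using lmk by (intro exI[of _ s] exI[of _ k]) (simp add: hits_def)
  qed
  then obtain S k where Sk: "\<And>p. p \<in> {..<K} \<times> {..<K} \<Longrightarrow> p \<noteq> (0, 0) \<Longrightarrow>
      S p < M \<and> 0 < k p \<and> k p < K \<and> hits (S p) (k p) p" by metis
  define \<mu> where "\<mu> p = (if p = (0, 0) then single 0 0 else single (S p) (k p))" for p
  show ?thesis
  proof (rule that[of w \<gamma> \<mu>])
    show "(\<Sum>i<K. (cmod (w s \<tau> i))\<^sup>2) = 1" if "s < M" for s \<tau> by (rule w[OF that])
  next
    fix l m :: nat and \<tau> :: "nat \<Rightarrow> nat"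
    assume lm: "l < K" "m < K"
    show "(\<Sum>s<M. hw_expect K (w s (\<tau> s)) l m) / of_nat M
         = (\<Sum>a\<in>ZK_vec K M. \<gamma> (l, m) a * (\<Prod>s<M. zeta K (int (\<tau> s)) ^ a s))"
    proof (cases "(l, m) = (0, 0)")
      case True
      have "(\<Sum>a\<in>ZK_vec K M. \<gamma> (l, m) a * (\<Prod>s<M. zeta K (int (\<tau> s)) ^ a s))
          = (\<Sum>a\<in>ZK_vec K M. if a = single 0 0 then (\<Prod>s<M. zeta K (int (\<tau> s)) ^ a s) else 0)"
        using True by (intro sum.cong) (auto simp: \<gamma>_def)
      also have "\<dots> = 1" using single_mem[OF K0] prod_single[OF M] by simp
      also have "1 = (\<Sum>s<M. hw_expect K (w s (\<tau> s)) l m) / of_nat M"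
        using True M w by (simp add: hw_expect_0_0)
      finally show ?thesis ..
    next
      case False
      have no_hit: "\<not> hits s 0 (l, m)" for s
        using False lm int_dvd_diff_iff_eq[of 0 K] K0 by (auto simp: hits_def dest: zdvd_imp_le)
      have "(\<Sum>a\<in>ZK_vec K M. \<gamma> (l, m) a * (\<Prod>s<M. zeta K (int (\<tau> s)) ^ a s))
          = (\<Sum>a\<in>ZK_vec K M. \<Sum>s<M. \<Sum>k\<in>{1..<K}. if a = single s k then
               (if hits s k (l, m) then \<phi> s k / of_nat M * (\<Prod>s<M. zeta K (int (\<tau> s)) ^ a s) else 0) else 0)"
        using False by (auto simp: \<gamma>_def sum_distrib_right intro!: sum.cong)
      also have "\<dots> = (\<Sum>s<M. \<Sum>k\<in>{1..<K}. \<Sum>a\<in>ZK_vec K M. if a = single s k then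
               (if hits s k (l, m) then \<phi> s k / of_nat M * (\<Prod>s<M. zeta K (int (\<tau> s)) ^ a s) else 0) else 0)"
        by (subst sum.swap, rule sum.cong[OF refl], rule sum.swap)
      also have "\<dots> = (\<Sum>s<M. \<Sum>k\<in>{1..<K}. if hits s k (l, m)
               then \<phi> s k / of_nat M * zeta K (int (\<tau> s)) ^ k else 0)"
        by (intro sum.cong refl) (simp add: single_mem prod_single)
      also have "\<dots> = (\<Sum>s<M. hw_expect K (w s (\<tau> s)) l m / of_nat M)"
      proof (intro sum.cong refl)
        fix s assume "s \<in> {..<M}"
        hence s: "s < M" by simp
        have "hw_expect K (w s (\<tau> s)) l m / of_nat M
            = (\<Sum>k<K. if hits s k (l, m) then \<phi> s k / of_nat M * zeta K (int (\<tau> s)) ^ k else 0)"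
          by (auto simp: expect[OF s] sum_divide_distrib zeta_power intro!: sum.cong)
        also have "\<dots> = (\<Sum>k\<in>{1..<K}. if hits s k (l, m) then \<phi> s k / of_nat M * zeta K (int (\<tau> s)) ^ k else 0)"
          by (rule sum.mono_neutral_right) (auto simp: no_hit not_less_eq_eq)
        finally show "(\<Sum>k\<in>{1..<K}. if hits s k (l, m) then \<phi> s k / of_nat M * zeta K (int (\<tau> s)) ^ k else 0)
          = hw_expect K (w s (\<tau> s)) l m / of_nat M" ..
      qed
      finally show ?thesis by (simp add: sum_divide_distrib)
    qed
  next
    fix p q a
    assume pq: "p \<in> {..<K} \<times> {..<K}" "q \<in> {..<K} \<times> {..<K}" and nz: "\<gamma> p a \<noteq> 0" "\<gamma> q a \<noteq> 0"
    show "p = q"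
    proof (cases "p = (0, 0) \<or> q = (0, 0)")
      case True
      hence "a = single 0 0" using \<gamma>_zero_nonzero nz by auto
      thus ?thesis using \<gamma>_nonzero[OF nz(1)] \<gamma>_nonzero[OF nz(2)] single_zero by metis
    next
      case False
      then obtain s k s' k' where "s < M" "0 < k" "hits s k p" "a = single s k"
        "hits s' k' q" "a = single s' k'"
        using \<gamma>_nonzero[OF nz(1)] \<gamma>_nonzero[OF nz(2)] by metis
      thus ?thesis using single_inject hits_inject pq by metis
    qed
  next
    fix p :: "nat \<times> nat" assume p: "p \<in> {..<K} \<times> {..<K}"
    show "\<mu> p \<in> ZK_vec K M" using Sk[OF p] single_mem K0 by (simp add: \<mu>_def)
    show "cmod (\<gamma> p (\<mu> p)) = (if p = (0, 0) then 1 else 1 / of_nat M)"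
    proof (cases "p = (0, 0)")
      case False
      note Sk = Sk[OF p False]
      have match: "hits s j p \<and> single (S p) (k p) = single s j \<longleftrightarrow> s = S p \<and> j = k p" for s j
        using Sk single_inject[of "S p" "k p" s j] by blast
      have "\<gamma> p (\<mu> p) = (\<Sum>s<M. \<Sum>j\<in>{1..<K}. if s = S p \<and> j = k p then \<phi> s j / of_nat M else 0)"
        using False unfolding \<gamma>_def \<mu>_def by (simp only: match if_False)
      also have "\<dots> = (\<Sum>s<M. if s = S p then (\<Sum>j\<in>{1..<K}. if j = k p then \<phi> s j / of_nat M else 0) else 0)"
        by (intro sum.cong) auto
      also have "\<dots> = \<phi> (S p) (k p) / of_nat M" using Sk by simp
      finally show ?thesis using False Sk \<phi> by (simp add: norm_divide)
    qed (simp add: \<gamma>_def \<mu>_def)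
  next
    fix p a assume nz: "\<gamma> p a \<noteq> 0"
    show "(\<Sum>s<M. a s) \<le> (if p = (0, 0) then 0 else K - 1)"
    proof (cases "p = (0, 0)")
      case True
      hence "a = single 0 0" using \<gamma>_zero_nonzero nz by simp
      hence "(\<Sum>s<M. a s) = 0" by (simp only: sum_single[OF M])
      thus ?thesis by simp
    next
      case False
      then obtain s k where "s < M" "k < K" "a = single s k" using \<gamma>_nonzero[OF nz] by metis
      thus ?thesis using False sum_single by simp
    qed
  qed
qed

section \<open>Transference to the cyclic group\<close>

text \<open>The \<open>n * M\<close> scalar variables are read as \<open>n\<close> blocks of \<open>M\<close> variables, one block for each
  tensor factor.\<close>

definition block :: "nat \<Rightarrow> nat \<Rightarrow> (nat \<Rightarrow> nat) \<Rightarrow> nat \<Rightarrow> nat" where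
  "block M t \<alpha> = (\<lambda>s\<in>{..<M}. \<alpha> (t * M + s))"

lemma block_index_less: "t < n \<Longrightarrow> s < M \<Longrightarrow> t * M + s < n * (M :: nat)"
proof -
  assume "t < n" "s < M"
  hence "t * M + s < (t + 1) * M" by simp
  also have "\<dots> \<le> n * M" using \<open>t < n\<close> by (intro mult_le_mono1) simp
  finally show ?thesis .
qed

lemma sum_prod_blocks:
  fixes G :: "nat \<Rightarrow> (nat \<Rightarrow> nat) \<Rightarrow> 'a :: comm_semiring_1"
  shows "(\<Sum>\<alpha>\<in>ZK_vec K (n * M). \<Prod>t<n. G t (block M t \<alpha>)) = (\<Prod>t<n. \<Sum>a\<in>ZK_vec K M. G t a)"
proof -
  have "(\<Prod>t<n. \<Sum>a\<in>ZK_vec K M. G t a) = (\<Sum>g\<in>{..<n} \<rightarrow>\<^sub>E ZK_vec K M. \<Prod>t<n. G t (g t))"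
    by (rule prod_sum_PiE) auto
  also have "\<dots> = (\<Sum>\<alpha>\<in>ZK_vec K (n * M). \<Prod>t<n. G t (block M t \<alpha>))"
  proof (rule sum.reindex_bij_witness[where i = "\<lambda>\<alpha>. \<lambda>t\<in>{..<n}. block M t \<alpha>"
        and j = "\<lambda>g. \<lambda>j\<in>{..<n * M}. g (j div M) (j mod M)"])
    fix g assume g: "g \<in> {..<n} \<rightarrow>\<^sub>E ZK_vec K M"
    have block_g: "block M t (\<lambda>j\<in>{..<n * M}. g (j div M) (j mod M)) = g t" if t: "t < n" for t
    proof
      fix s
      show "block M t (\<lambda>j\<in>{..<n * M}. g (j div M) (j mod M)) s = g t s"
      proof (cases "s < M")
        case True
        thus ?thesis using block_index_less[OF t True] by (simp add: block_def)
      next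
        case False
        thus ?thesis using g t by (auto simp: block_def ZK_vec_def PiE_def Pi_def extensional_def)
      qed
    qed
    show "(\<lambda>t\<in>{..<n}. block M t (\<lambda>j\<in>{..<n * M}. g (j div M) (j mod M))) = g"
      using g block_g by (auto simp: PiE_def extensional_def)
    show "(\<lambda>j\<in>{..<n * M}. g (j div M) (j mod M)) \<in> ZK_vec K (n * M)"
      unfolding ZK_vec_def
    proof (rule restrict_PiE_iff[THEN iffD2], rule ballI)
      fix j assume "j \<in> {..<n * M}"
      hence "j div M < n" "j mod M < M"
        by (auto simp: less_mult_imp_div_less intro!: mod_less_divisor) (metis mult_0_right not_less0 neq0_conv)
      thus "g (j div M) (j mod M) \<in> {..<K}" using g ZK_vec_less by (auto simp: PiE_def Pi_def)
    qed
    show "(\<Prod>t<n. G t (block M t (\<lambda>j\<in>{..<n * M}. g (j div M) (j mod M)))) = (\<Prod>t<n. G t (g t))"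
      using block_g by simp
  next
    fix \<alpha> assume \<alpha>: "\<alpha> \<in> ZK_vec K (n * M)"
    show "(\<lambda>t\<in>{..<n}. block M t \<alpha>) \<in> {..<n} \<rightarrow>\<^sub>E ZK_vec K M"
      using \<alpha> block_index_less by (auto simp: block_def ZK_vec_def PiE_def Pi_def)
    show "(\<lambda>j\<in>{..<n * M}. (\<lambda>t\<in>{..<n}. block M t \<alpha>) (j div M) (j mod M)) = \<alpha>"
    proof
      fix j
      show "(\<lambda>j\<in>{..<n * M}. (\<lambda>t\<in>{..<n}. block M t \<alpha>) (j div M) (j mod M)) j = \<alpha> j"
      proof (cases "j < n * M")
        case True
        hence "M > 0" by (metis mult_0_right not_less0 neq0_conv)
        thus ?thesis using True by (simp add: less_mult_imp_div_less block_def)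
      next
        case False
        thus ?thesis using \<alpha> by (simp add: ZK_vec_def PiE_def extensional_def)
      qed
    qed
  qed
  finally show ?thesis ..
qed

lemma prod_blocks:
  fixes g :: "nat \<Rightarrow> 'a :: comm_monoid_mult"
  shows "(\<Prod>j<n * M. g j) = (\<Prod>t<n. \<Prod>s<M. g (t * M + s))"
proof -
  have "(\<Prod>s\<in>{t * M..<t * M + M}. g s) = (\<Prod>s<M. g (t * M + s))" for t
    using prod.shift_bounds_nat_ivl[of g 0 "t * M" M] by (simp add: atLeast0LessThan add.commute)
  thus ?thesis by (simp add: prod.nat_group[symmetric])
qed

lemma sum_blocks:
  fixes g :: "nat \<Rightarrow> 'a :: comm_monoid_add"
  shows "(\<Sum>j<n * M. g j) = (\<Sum>t<n. \<Sum>s<M. g (t * M + s))"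
proof -
  have "(\<Sum>s\<in>{t * M..<t * M + M}. g s) = (\<Sum>s<M. g (t * M + s))" for t
    using sum.shift_bounds_nat_ivl[of g 0 "t * M" M] by (simp add: atLeast0LessThan add.commute)
  thus ?thesis by (simp add: sum.nat_group[symmetric])
qed

text \<open>Every nontrivial tensor factor costs at least one degree, so a basis element of degree \<open>d\<close>
  acts nontrivially on at most \<open>d\<close> factors. It turns into monomials of degree at most \<open>K - 1\<close> in each
  of these blocks, and its coefficient loses a factor \<open>M\<close> for each of them. This gives both the
  degree \<open>(K - 1) * d\<close> and the constant \<open>M ^ d\<close>.\<close>

lemma transference:
  assumes K: "K \<ge> 2" and M_def: "M = card (Sigma_K K)"
    and A: "A \<in> carrier_mat (K ^ n) (K ^ n)" and deg: "hw_degree_le K n d A"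
  obtains f \<iota> where
    "cyc_degree_le K (n * M) ((K - 1) * d) f"
    "\<And>z. z \<in> Omega_vec K (n * M) \<Longrightarrow> cmod (f z) \<le> op_norm A"
    "inj_on \<iota> (ZK_vec K n \<times> ZK_vec K n)"
    "\<iota> ` (ZK_vec K n \<times> ZK_vec K n) \<subseteq> ZK_vec K (n * M)"
    "\<And>p. p \<in> ZK_vec K n \<times> ZK_vec K n \<Longrightarrow>
       cmod (hw_coeff K n A p) \<le> real M ^ d * cmod (cyc_coeff K (n * M) f (\<iota> p))"
proof -
  have K0: "K > 0" using K by simp
  have M: "M > 0" using card_Sigma_K_pos[OF K] M_def by simp
  let ?W = "ZK_vec K n \<times> ZK_vec K n"
  obtain \<gamma> :: "nat \<times> nat \<Rightarrow> (nat \<Rightarrow> nat) \<Rightarrow> complex"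
    and \<mu> :: "nat \<times> nat \<Rightarrow> nat \<Rightarrow> nat" and w :: "nat \<Rightarrow> nat \<Rightarrow> nat \<Rightarrow> complex"
    where w: "\<And>s \<tau>. s < M \<Longrightarrow> (\<Sum>i<K. (cmod (w s \<tau> i))\<^sup>2) = 1"
    and site_poly: "\<And>l m \<tau>. l < K \<Longrightarrow> m < K \<Longrightarrow>
       (\<Sum>s<M. hw_expect K (w s (\<tau> s)) l m) / of_nat M
         = (\<Sum>a\<in>ZK_vec K M. \<gamma> (l, m) a * (\<Prod>s<M. zeta K (int (\<tau> s)) ^ a s))"
    and \<gamma>_inject: "\<And>p q a. p \<in> {..<K} \<times> {..<K} \<Longrightarrow> q \<in> {..<K} \<times> {..<K} \<Longrightarrow>
       \<gamma> p a \<noteq> 0 \<Longrightarrow> \<gamma> q a \<noteq> 0 \<Longrightarrow> p = q"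
    and \<mu>_mem: "\<And>p. p \<in> {..<K} \<times> {..<K} \<Longrightarrow> \<mu> p \<in> ZK_vec K M"
    and \<gamma>_\<mu>: "\<And>p. p \<in> {..<K} \<times> {..<K} \<Longrightarrow>
       cmod (\<gamma> p (\<mu> p)) = (if p = (0, 0) then 1 else 1 / of_nat M)"
    and \<gamma>_degree: "\<And>p a. \<gamma> p a \<noteq> 0 \<Longrightarrow> (\<Sum>s<M. a s) \<le> (if p = (0, 0) then 0 else K - 1)"
    by (rule site_polynomial[OF K M_def]) (rule that)
  define site where "site p t = (fst p t, snd p t)" for p :: "(nat \<Rightarrow> nat) \<times> (nat \<Rightarrow> nat)" and t
  have site_mem: "site p t \<in> {..<K} \<times> {..<K}" if "p \<in> ?W" "t < n" for p t
    using that ZK_vec_less by (auto simp: site_def)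
  have site_inject: "p = q" if "p \<in> ?W" "q \<in> ?W" "\<And>t. t < n \<Longrightarrow> site p t = site q t" for p q
  proof (rule prod_eqI)
    show "fst p = fst q" "snd p = snd q"
      using that by (auto simp: site_def intro: ZK_vec_eqI[of _ K n])
  qed
  define lg where "lg u = (SOME \<tau>. u = zeta K (int \<tau>))" for u
  have lg: "zeta K (int (lg u)) = u" if "u \<in> Omega K" for u
  proof -
    have "\<exists>\<tau>. u = zeta K (int \<tau>)" using that by (auto simp: Omega_def omega_power)
    thus ?thesis unfolding lg_def by (metis (mono_tags, lifting) someI_ex)
  qed
  define f where "f z = (\<Sum>p\<in>?W. hw_coeff K n A p *
      (\<Prod>t<n. (\<Sum>s<M. hw_expect K (w s (lg (z (t * M + s)))) (fst p t) (snd p t)) / of_nat M))" for z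
  define c where "c \<alpha> = (\<Sum>p\<in>?W. hw_coeff K n A p * (\<Prod>t<n. \<gamma> (site p t) (block M t \<alpha>)))" for \<alpha>
  \<comment> \<open>Expanding the product of averages over \<open>\<Sigma>\<close> exhibits \<open>f z\<close> as an average of expectations of \<open>A\<close>
    in product states, one for each choice \<open>\<sigma>\<close> of an element of \<open>\<Sigma>\<close> at every factor.\<close>
  have f_bound: "cmod (f z) \<le> op_norm A" for z
  proof -
    have "f z = (\<Sum>p\<in>?W. \<Sum>\<sigma>\<in>ZK_vec M n. hw_coeff K n A p *
        (\<Prod>t<n. hw_expect K (w (\<sigma> t) (lg (z (t * M + \<sigma> t)))) (fst p t) (snd p t)) / of_nat M ^ n)"
      unfolding f_def prod_dividef sum_prod_ZK_vec[symmetric]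
      by (simp add: sum_distrib_left sum_divide_distrib)
    also have "\<dots> = (\<Sum>\<sigma>\<in>ZK_vec M n. (\<Sum>p\<in>?W. hw_coeff K n A p *
        (\<Prod>t<n. hw_expect K (w (\<sigma> t) (lg (z (t * M + \<sigma> t)))) (fst p t) (snd p t))) / of_nat M ^ n)"
      by (subst sum.swap) (simp add: sum_divide_distrib)
    also have "cmod \<dots> \<le> (\<Sum>\<sigma>\<in>ZK_vec M n. op_norm A / of_nat M ^ n)"
    proof (rule sum_norm_le)
      fix \<sigma> assume \<sigma>: "\<sigma> \<in> ZK_vec M n"
      have "cmod (\<Sum>(l, m)\<in>?W. hw_coeff K n A (l, m) *
         (\<Prod>t<n. hw_expect K (w (\<sigma> t) (lg (z (t * M + \<sigma> t)))) (l t) (m t))) \<le> op_norm A"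
        by (rule product_state_expectation_le_op_norm[OF K0 A]) (rule w, rule ZK_vec_less[OF \<sigma>])
      thus "cmod ((\<Sum>p\<in>?W. hw_coeff K n A p *
         (\<Prod>t<n. hw_expect K (w (\<sigma> t) (lg (z (t * M + \<sigma> t)))) (fst p t) (snd p t))) / of_nat M ^ n)
           \<le> op_norm A / of_nat M ^ n"
        using M by (simp add: norm_divide norm_power case_prod_beta divide_right_mono)
    qed
    also have "\<dots> = op_norm A" using M by (simp add: ZK_vec_def card_PiE)
    finally show ?thesis .
  qed
  \<comment> \<open>Expanding each factor by its site polynomial exhibits \<open>f\<close> as a polynomial instead.\<close>
  have f_expand: "f z = (\<Sum>\<alpha>\<in>ZK_vec K (n * M). c \<alpha> * (\<Prod>j<n * M. z j ^ \<alpha> j))"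
    if z: "z \<in> Omega_vec K (n * M)" for z
  proof -
    have z_lg: "zeta K (int (lg (z (t * M + s)))) = z (t * M + s)" if "t < n" "s < M" for t s
      using z block_index_less[OF that] by (intro lg) (auto simp: Omega_vec_def PiE_def Pi_def)
    have "f z = (\<Sum>p\<in>?W. hw_coeff K n A p * (\<Prod>t<n. \<Sum>a\<in>ZK_vec K M.
        \<gamma> (site p t) a * (\<Prod>s<M. z (t * M + s) ^ a s)))"
      unfolding f_def
    proof (intro sum.cong refl arg_cong[where f = "(*) _"] prod.cong)
      fix p t assume p: "p \<in> ?W" and t: "t \<in> {..<n}"
      have "(\<Sum>s<M. hw_expect K (w s (lg (z (t * M + s)))) (fst p t) (snd p t)) / of_nat M
          = (\<Sum>a\<in>ZK_vec K M. \<gamma> (site p t) a * (\<Prod>s<M. zeta K (int (lg (z (t * M + s)))) ^ a s))"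
        unfolding site_def using site_mem[OF p, of t] t by (intro site_poly) (auto simp: site_def)
      also have "\<dots> = (\<Sum>a\<in>ZK_vec K M. \<gamma> (site p t) a * (\<Prod>s<M. z (t * M + s) ^ a s))"
        using t z_lg by simp
      finally show "(\<Sum>s<M. hw_expect K (w s (lg (z (t * M + s)))) (fst p t) (snd p t)) / of_nat M
          = (\<Sum>a\<in>ZK_vec K M. \<gamma> (site p t) a * (\<Prod>s<M. z (t * M + s) ^ a s))" .
    qed
    also have "\<dots> = (\<Sum>p\<in>?W. \<Sum>\<alpha>\<in>ZK_vec K (n * M). hw_coeff K n A p * (\<Prod>t<n. \<gamma> (site p t) (block M t \<alpha>))
        * (\<Prod>j<n * M. z j ^ \<alpha> j))"
      unfolding sum_prod_blocks[symmetric]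
      by (simp add: sum_distrib_left prod.distrib prod_blocks block_def mult.assoc)
    also have "\<dots> = (\<Sum>\<alpha>\<in>ZK_vec K (n * M). c \<alpha> * (\<Prod>j<n * M. z j ^ \<alpha> j))"
      by (subst sum.swap) (simp add: c_def sum_distrib_right)
    finally show ?thesis .
  qed
  have coeff: "cyc_coeff K (n * M) f \<alpha> = c \<alpha>" if "\<alpha> \<in> ZK_vec K (n * M)" for \<alpha>
    using K0 f_expand that by (rule cyc_coeff_eqI)
  have support: "card {t. t < n \<and> site p t \<noteq> (0, 0)} \<le> d" if p: "p \<in> ?W" "hw_coeff K n A p \<noteq> 0" for p
  proof -
    have "card {t. t < n \<and> site p t \<noteq> (0, 0)} = (\<Sum>t<n. if site p t \<noteq> (0, 0) then 1 else 0)"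
      by (subst sum.If_cases) (auto intro!: arg_cong[where f = card])
    also have "\<dots> \<le> (\<Sum>t<n. fst p t + snd p t)"
      by (intro sum_mono) (auto simp: site_def)
    also have "\<dots> \<le> d"
    proof (rule ccontr)
      assume "\<not> (\<Sum>t<n. fst p t + snd p t) \<le> d"
      hence "hw_coeff K n A (fst p, snd p) = 0"
        using deg p(1) unfolding hw_degree_le_def by (auto simp: not_le)
      thus False using p(2) by simp
    qed
    finally show ?thesis .
  qed
  define \<iota> where "\<iota> p = (\<lambda>j\<in>{..<n * M}. \<mu> (site p (j div M)) (j mod M))" for p
  have \<iota>_mem: "\<iota> p \<in> ZK_vec K (n * M)" if p: "p \<in> ?W" for p
    unfolding \<iota>_def ZK_vec_def
  proof (rule restrict_PiE_iff[THEN iffD2], rule ballI)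
    fix j assume "j \<in> {..<n * M}"
    hence "j div M < n" "j mod M < M" using M by (auto simp: less_mult_imp_div_less)
    thus "\<mu> (site p (j div M)) (j mod M) \<in> {..<K}"
      using ZK_vec_less[OF \<mu>_mem[OF site_mem[OF p]]] by simp
  qed
  have block_\<iota>: "block M t (\<iota> p) = \<mu> (site p t)" if p: "p \<in> ?W" and t: "t < n" for p t
  proof
    fix s
    show "block M t (\<iota> p) s = \<mu> (site p t) s"
    proof (cases "s < M")
      case True
      thus ?thesis using block_index_less[OF t True] by (simp add: block_def \<iota>_def)
    next
      case False
      thus ?thesis using \<mu>_mem[OF site_mem[OF p t]]
        by (simp add: block_def ZK_vec_def PiE_def extensional_def)
    qed
  qed
  have \<gamma>_\<mu>_nonzero: "\<gamma> (site p t) (\<mu> (site p t)) \<noteq> 0" if "p \<in> ?W" "t < n" for p t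
  proof -
    have "cmod (\<gamma> (site p t) (\<mu> (site p t))) > 0" using \<gamma>_\<mu>[OF site_mem[OF that]] M by simp
    thus ?thesis by auto
  qed
  have \<gamma>_\<mu>_inject: "p = q"
    if "p \<in> ?W" "q \<in> ?W" "\<And>t. t < n \<Longrightarrow> \<gamma> (site q t) (\<mu> (site p t)) \<noteq> 0" for p q
    using that(1,2)
  proof (rule site_inject)
    fix t assume t: "t < n"
    show "site p t = site q t"
      by (rule \<gamma>_inject[OF site_mem[OF that(1) t] site_mem[OF that(2) t] \<gamma>_\<mu>_nonzero[OF that(1) t] that(3)[OF t]])
  qed
  \<comment> \<open>Blockwise, a monomial determines the basis element it comes from, so only one summand of \<open>c\<close> survives.\<close>
  have c_\<iota>: "c (\<iota> p) = hw_coeff K n A p * (\<Prod>t<n. \<gamma> (site p t) (\<mu> (site p t)))" if p: "p \<in> ?W" for p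
  proof -
    have "c (\<iota> p) = (\<Sum>q\<in>?W. hw_coeff K n A q * (\<Prod>t<n. \<gamma> (site q t) (\<mu> (site p t))))"
      unfolding c_def using p by (simp add: block_\<iota>)
    also have "\<dots> = (\<Sum>q\<in>?W. if q = p then hw_coeff K n A p * (\<Prod>t<n. \<gamma> (site p t) (\<mu> (site p t))) else 0)"
    proof (intro sum.cong refl)
      fix q assume q: "q \<in> ?W"
      show "hw_coeff K n A q * (\<Prod>t<n. \<gamma> (site q t) (\<mu> (site p t)))
        = (if q = p then hw_coeff K n A p * (\<Prod>t<n. \<gamma> (site p t) (\<mu> (site p t))) else 0)"
      proof (cases "q = p")
        case False
        then obtain t where "t < n" "\<gamma> (site q t) (\<mu> (site p t)) = 0" using \<gamma>_\<mu>_inject[OF p q] by metis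
        hence "(\<Prod>t<n. \<gamma> (site q t) (\<mu> (site p t))) = 0" by (intro prod_zero) auto
        thus ?thesis using False by simp
      qed simp
    qed
    also have "\<dots> = hw_coeff K n A p * (\<Prod>t<n. \<gamma> (site p t) (\<mu> (site p t)))"
      using p by (simp add: sum.delta[OF finite_cartesian_product] del: mem_Sigma_iff)
    finally show ?thesis .
  qed
  show ?thesis
  proof (rule that[of f \<iota>])
    show "cyc_degree_le K (n * M) ((K - 1) * d) f"
      unfolding cyc_degree_le_def
    proof (intro ballI impI)
      fix \<alpha> assume \<alpha>: "\<alpha> \<in> ZK_vec K (n * M)" and large: "(\<Sum>j<n * M. \<alpha> j) > (K - 1) * d"
      have "c \<alpha> = 0"
        unfolding c_def
      proof (intro sum.neutral ballI)
        fix p assume p: "p \<in> ?W"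
        show "hw_coeff K n A p * (\<Prod>t<n. \<gamma> (site p t) (block M t \<alpha>)) = 0"
        proof (rule ccontr)
          assume *: "hw_coeff K n A p * (\<Prod>t<n. \<gamma> (site p t) (block M t \<alpha>)) \<noteq> 0"
          hence nz: "\<gamma> (site p t) (block M t \<alpha>) \<noteq> 0" if "t < n" for t using that by auto
          have "(\<Sum>j<n * M. \<alpha> j) = (\<Sum>t<n. \<Sum>s<M. block M t \<alpha> s)"
            by (simp add: sum_blocks block_def)
          also have "\<dots> \<le> (\<Sum>t<n. if site p t \<noteq> (0, 0) then K - 1 else 0)"
            by (intro sum_mono order_trans[OF \<gamma>_degree[OF nz]]) auto
          also have "\<dots> = (K - 1) * card {t. t < n \<and> site p t \<noteq> (0, 0)}"
            by (subst sum.If_cases) (auto intro!: arg_cong[where f = card])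
          also have "\<dots> \<le> (K - 1) * d" using * by (intro mult_le_mono2 support[OF p]) auto
          finally show False using large by simp
        qed
      qed
      thus "cyc_coeff K (n * M) f \<alpha> = 0" using coeff[OF \<alpha>] by simp
    qed
    show "cmod (f z) \<le> op_norm A" for z by (rule f_bound)
    show "inj_on \<iota> ?W"
    proof (rule inj_onI)
      fix p q assume p: "p \<in> ?W" and q: "q \<in> ?W" and eq: "\<iota> p = \<iota> q"
      show "p = q"
      proof (rule \<gamma>_\<mu>_inject[OF p q])
        fix t assume t: "t < n"
        have "\<mu> (site p t) = \<mu> (site q t)" using block_\<iota>[OF p t] block_\<iota>[OF q t] eq by simp
        thus "\<gamma> (site q t) (\<mu> (site p t)) \<noteq> 0" using \<gamma>_\<mu>_nonzero[OF q t] by simp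
      qed
    qed
    show "\<iota> ` ?W \<subseteq> ZK_vec K (n * M)" using \<iota>_mem by blast
    fix p assume p: "p \<in> ?W"
    show "cmod (hw_coeff K n A p) \<le> real M ^ d * cmod (cyc_coeff K (n * M) f (\<iota> p))"
    proof (cases "hw_coeff K n A p = 0")
      case False
      let ?r = "card {t. t < n \<and> site p t \<noteq> (0, 0)}"
      have "cmod (\<Prod>t<n. \<gamma> (site p t) (\<mu> (site p t))) = (\<Prod>t<n. if site p t \<noteq> (0, 0) then 1 / real M else 1)"
        unfolding prod_norm[symmetric] by (intro prod.cong) (auto simp: \<gamma>_\<mu>[OF site_mem[OF p]])
      also have "\<dots> = (1 / real M) ^ ?r"
        by (subst prod.If_cases) (simp_all add: Int_def)
      finally have "real M ^ ?r * cmod (c (\<iota> p)) = cmod (hw_coeff K n A p)"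
        using M by (simp add: c_\<iota>[OF p] norm_mult power_divide)
      moreover have "real M ^ ?r * cmod (c (\<iota> p)) \<le> real M ^ d * cmod (c (\<iota> p))"
        using support[OF p False] M by (intro mult_right_mono power_increasing) auto
      ultimately show ?thesis using coeff[OF \<iota>_mem[OF p]] by simp
    qed simp
  qed
qed

section \<open>Comparison of the constants\<close>

lemma hw_coeff_norm_le:
  assumes D: "D \<ge> 1" and C: "C \<ge> 0" "cyc_BH_valid K D C" and N: "N \<ge> 1" and B: "B \<ge> 0" and K: "K > 0"
    and deg: "cyc_degree_le K N D f"
    and f: "\<And>z. z \<in> Omega_vec K N \<Longrightarrow> cmod (f z) \<le> S"
    and inj: "inj_on \<iota> (ZK_vec K n \<times> ZK_vec K n)" "\<iota> ` (ZK_vec K n \<times> ZK_vec K n) \<subseteq> ZK_vec K N"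
    and le: "\<And>p. p \<in> ZK_vec K n \<times> ZK_vec K n \<Longrightarrow>
       cmod (hw_coeff K n A p) \<le> B * cmod (cyc_coeff K N f (\<iota> p))"
  shows "hw_coeff_norm K n (2 * real D / (real D + 1)) A \<le> B * (C * S)"
proof -
  let ?W = "ZK_vec K n \<times> ZK_vec K n"
  define r where "r = 2 * real D / (real D + 1)"
  have r: "r > 0" "1 / r = (real D + 1) / (2 * real D)" using D by (auto simp: r_def)
  have "(\<Sum>p\<in>?W. cmod (hw_coeff K n A p) powr r) \<le> (\<Sum>p\<in>?W. B powr r * cmod (cyc_coeff K N f (\<iota> p)) powr r)"
    using r(1) le B by (intro sum_mono) (auto simp: powr_mult[symmetric] simp del: mem_Sigma_iff intro!: powr_mono2)
  also have "\<dots> = B powr r * (\<Sum>\<alpha>\<in>\<iota> ` ?W. cmod (cyc_coeff K N f \<alpha>) powr r)"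
    by (simp add: sum.reindex[OF inj(1)] sum_distrib_left)
  also have "\<dots> \<le> B powr r * (\<Sum>\<alpha>\<in>ZK_vec K N. cmod (cyc_coeff K N f \<alpha>) powr r)"
    using inj(2) by (intro mult_left_mono sum_mono2) auto
  finally have "hw_coeff_norm K n r A
      \<le> (B powr r * (\<Sum>\<alpha>\<in>ZK_vec K N. cmod (cyc_coeff K N f \<alpha>) powr r)) powr (1 / r)"
    unfolding hw_coeff_norm_def using r(1) by (intro powr_mono2) (auto intro: sum_nonneg)
  also have "\<dots> = B * (\<Sum>\<alpha>\<in>ZK_vec K N. cmod (cyc_coeff K N f \<alpha>) powr r) powr (1 / r)"
    using r(1) B by (simp add: powr_mult powr_powr sum_nonneg)
  also have "(\<Sum>\<alpha>\<in>ZK_vec K N. cmod (cyc_coeff K N f \<alpha>) powr r) powr (1 / r)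
      \<le> C * (SUP z\<in>Omega_vec K N. cmod (f z))"
    unfolding r(2) unfolding r_def by (rule C(2)[unfolded cyc_BH_valid_def, rule_format, OF N deg])
  also have "(SUP z\<in>Omega_vec K N. cmod (f z)) \<le> S"
    using K f by (intro cSUP_least) (auto simp: Omega_vec_def Omega_def PiE_eq_empty_iff)
  finally show ?thesis using B C(1) by (simp add: r_def mult_left_mono)
qed

lemma hw_coeff_norm_le_BH_Omega:
  assumes K: "K \<ge> 2" and d: "d \<ge> 1" and n: "n \<ge> 1"
    and A: "A \<in> carrier_mat (K ^ n) (K ^ n)" and deg: "hw_degree_le K n d A"
  defines "D \<equiv> (K - 1) * d"
  shows "ennreal (hw_coeff_norm K n (2 * real D / (real D + 1)) A)
    \<le> of_nat (card (Sigma_K K)) ^ d * BH_Omega K D * ennreal (op_norm A)"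
proof -
  define M where "M = card (Sigma_K K)"
  let ?h = "hw_coeff_norm K n (2 * real D / (real D + 1)) A"
  have K0: "K > 0" and M: "M > 0" using card_Sigma_K_pos[OF K] K by (auto simp: M_def)
  have D: "D \<ge> 1" using K d by (simp add: D_def)
  have N: "n * M \<ge> 1" using n M by (simp add: Suc_le_eq)
  obtain f \<iota> where f: "cyc_degree_le K (n * M) D f"
      "\<And>z. z \<in> Omega_vec K (n * M) \<Longrightarrow> cmod (f z) \<le> op_norm A"
    and \<iota>: "inj_on \<iota> (ZK_vec K n \<times> ZK_vec K n)"
      "\<iota> ` (ZK_vec K n \<times> ZK_vec K n) \<subseteq> ZK_vec K (n * M)"
    and le: "\<And>p. p \<in> ZK_vec K n \<times> ZK_vec K n \<Longrightarrow>
       cmod (hw_coeff K n A p) \<le> real M ^ d * cmod (cyc_coeff K (n * M) f (\<iota> p))"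
    using transference[OF K M_def A deg] unfolding D_def by metis
  have bound: "?h \<le> real M ^ d * (C * op_norm A)" if "C \<ge> 0" "cyc_BH_valid K D C" for C
    by (rule hw_coeff_norm_le[OF D that N _ K0 f \<iota> le]) simp_all
  show ?thesis
  proof (cases "op_norm A > 0")
    case True
    define P where "P = real M ^ d * op_norm A"
    have P: "P > 0" using True M by (simp add: P_def)
    have "ennreal (?h / P) \<le> BH_Omega K D"
      unfolding BH_Omega_def
    proof (rule INF_greatest)
      fix C assume "C \<in> {C. C \<ge> 0 \<and> cyc_BH_valid K D C}"
      hence "?h \<le> C * P" using bound[of C] by (simp add: P_def mult_ac)
      thus "ennreal (?h / P) \<le> ennreal C" using P by (intro ennreal_leI) (simp add: divide_le_eq)
    qed
    hence "ennreal P * ennreal (?h / P) \<le> ennreal P * BH_Omega K D" by (rule mult_left_mono) simp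
    moreover have "?h \<ge> 0" by (simp add: hw_coeff_norm_def)
    ultimately have "ennreal ?h \<le> ennreal P * BH_Omega K D"
      using P by (simp add: ennreal_mult[symmetric])
    also have "ennreal P = of_nat M ^ d * ennreal (op_norm A)"
      using True by (simp add: P_def ennreal_mult ennreal_power ennreal_of_nat_eq_real_of_nat)
    finally show ?thesis by (simp add: M_def mult_ac)
  next
    case False
    \<comment> \<open>In \<open>ennreal\<close> an infinite constant times zero is zero, so this case needs its own argument:
      the polynomial vanishes and with it all coefficients.\<close>
    have "f z = 0" if "z \<in> Omega_vec K (n * M)" for z
      using f(2)[OF that] False by (metis linorder_not_less norm_le_zero_iff order_trans)
    hence zero: "cyc_coeff K (n * M) f \<alpha> = 0" if "\<alpha> \<in> ZK_vec K (n * M)" for \<alpha>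
      using that by (intro cyc_coeff_eqI[OF K0, where c = "\<lambda>_. 0"]) auto
    have "hw_coeff K n A p = 0" if p: "p \<in> ZK_vec K n \<times> ZK_vec K n" for p
    proof -
      have "\<iota> p \<in> ZK_vec K (n * M)" using \<iota>(2) p by blast
      thus ?thesis using le[OF p] zero by simp
    qed
    hence "?h = 0" by (simp add: hw_coeff_norm_def del: mem_Sigma_iff)
    thus ?thesis by simp
  qed
qed

theorem theorem7:
  fixes K d :: nat
  assumes "K \<ge> 4" and "\<not> prime K" and "d \<ge> 1"
  shows "\<exists>C :: ennreal.
    (\<forall>n\<ge>1. \<forall>A\<in>carrier_mat (K ^ n) (K ^ n). observable A \<and> hw_degree_le K n d A \<longrightarrow>
       ennreal (hw_coeff_norm K n (2 * ((real K - 1) * real d) / ((real K - 1) * real d + 1)) A)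
         \<le> C * ennreal (op_norm A)) \<and>
    C \<le> of_nat K ^ (2 * d) * BH_Omega K ((K - 1) * d) \<and>
    C \<le> of_nat (card (Sigma_K K)) ^ d * BH_Omega K ((K - 1) * d)"
proof (intro exI[of _ "of_nat (card (Sigma_K K)) ^ d * BH_Omega K ((K - 1) * d)"] conjI allI ballI impI)
  fix n A
  assume "1 \<le> n" "A \<in> carrier_mat (K ^ n) (K ^ n)" "observable A \<and> hw_degree_le K n d A"
  moreover have "real ((K - 1) * d) = (real K - 1) * real d" using assms(1) by simp
  ultimately show "ennreal (hw_coeff_norm K n (2 * ((real K - 1) * real d) / ((real K - 1) * real d + 1)) A)
         \<le> of_nat (card (Sigma_K K)) ^ d * BH_Omega K ((K - 1) * d) * ennreal (op_norm A)"
    using hw_coeff_norm_le_BH_Omega[of K d n A] assms by simp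
next
  have "of_nat (card (Sigma_K K)) \<le> (of_nat (K\<^sup>2) :: ennreal)"
    using card_Sigma_K_le by (simp only: of_nat_le_iff)
  hence "of_nat (card (Sigma_K K)) ^ d \<le> (of_nat (K\<^sup>2) :: ennreal) ^ d" by (rule power_mono) simp
  also have "\<dots> = of_nat K ^ (2 * d)" by (simp add: power_mult)
  finally show "of_nat (card (Sigma_K K)) ^ d * BH_Omega K ((K - 1) * d)
      \<le> of_nat K ^ (2 * d) * BH_Omega K ((K - 1) * d)"
    by (rule mult_right_mono) simp
qed simp

end
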